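(* Let $A\in\mathbb{R}^{n\times d}$ be a nonzero matrix, let $f:\mathbb{R}^n\to\mathbb{R}$ and $g:\mathbb{R}^d\to\mathbb{R}$ be convex, and let $\mu=\sqrt{\lambda_{\min}(A^TA)}$ and $L=\|A\|=\sqrt{\lambda_{\max}(A^TA)}$. Assume that: (i) $f$ is $\delta$-strongly convex and $1/\gamma$-smooth, where $\gamma>0$, $\delta\ge0$ and $\gamma\delta\le1$; (ii) $g$ is $\lambda$-strongly convex, where $\lambda\ge0$; (iii) $\lambda+\delta\mu^2>0$. Let $(x^\star,y^\star)$ be the unique saddle point of $\mathcal{L}(x,y)=g(x)+y^TAx-f^*(y)$ (minimized over $x\in\mathbb{R}^d$, maximized over $y\in\mathbb{R}^n$). Set $$\tau=\frac{1}{2L}\sqrt{\frac{\gamma}{\lambda+\delta\mu^2}},\qquad\sigma=\frac{1}{2L}\sqrt{\gamma(\lambda+\delta\mu^2)},\qquad\theta=\max\{\theta_x,\theta_y\},$$ where $$\theta_x=\Bigl(1-\frac{\tau\sigma\delta\mu^2}{4+2\sigma}\Bigr)\frac{1}{1+\tau\lambda},\qquad\theta_y=\frac{1}{1+\sigma/2}.$$ Let $(x^{(t)},y^{(t)})_{t\ge0}$ be the iterates of the Dual-Free BPD algorithm (described in the context) run with these parameters from an initial point $(x^{(0)},y^{(0)})$. Then for every $t\ge1$, $$\Bigl(\frac{1}{2\tau}+\frac{\lambda}{2}\Bigr)\|x^{(t)}-x^\star\|^2+\frac12\mathcal{D}(y^\star,y^{(t)})\le\theta^tC,$$ $$\mathcal{L}(x^{(t)},y^\star)-\mathcal{L}(x^\star,y^{(t)})\le\theta^tC,$$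 where $$C=\Bigl(\frac{1}{2\tau}+\frac{\lambda}{2}\Bigr)\|x^{(0)}-x^\star\|^2+\Bigl(\frac1\sigma+\frac12\Bigr)\mathcal{D}(y^\star,y^{(0)}).$$
   Context: $\|\cdot\|$ is the Euclidean norm for vectors and the spectral norm for matrices. Strong convexity and smoothness are with respect to the Euclidean norm: a function $\phi$ is $\nu$-strongly convex ($\nu\ge0$; $\nu=0$ means just convex) if $\phi-\frac{\nu}{2}\|\cdot\|^2$ is convex, and $1/\gamma$-smooth if it is differentiable with $(1/\gamma)$-Lipschitz gradient. $f^*(y)=\sup_z\{y^Tz-f(z)\}$ is the convex conjugate; $f'$ and $(f^* )'$ denote gradients. For a convex function $\psi$ and $s>0$, $\mathrm{prox}_{s\psi}(z)=\arg\min_x\{s\psi(x)+\frac12\|x-z\|^2\}$. Dual-Free BPD algorithm with parameters $\sigma,\tau,\theta>0$ and initial point $(x^{(0)},y^{(0)})$ (with $f^*$ differentiable at $y^{(0)}$): set $\tilde x^{(0)}=x^{(0)}$ and $v^{(0)}=(f^* )'(y^{(0)})$. For $t=0,1,2,\ldots$ let $$v^{(t+1)}=\frac{v^{(t)}+\sigma A\tilde x^{(t)}}{1+\sigma},\qquad y^{(t+1)}=f'(v^{(t+1)}),$$ $$x^{(t+1)}=\mathrm{prox}_{\tau g}\bigl(x^{(t)}-\tau A^Ty^{(t+1)}\bigr),$$ $$\tilde x^{(t+1)}=x^{(t+1)}+\theta\bigl(x^{(t+1)}-x^{(t)}\bigr).$$ $\mathcal{D}$ is the Bregman divergence with kernel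 $f^*$: $\mathcal{D}(y,y')=f^*(y)-f^*(y')-\langle(f^* )'(y'),y-y'\rangle$. At the iterates the gradient $(f^* )'(y^{(t)})$ is represented by $v^{(t)}$, i.e. $\mathcal{D}(y,y^{(t)})=f^*(y)-f^*(y^{(t)})-\langle v^{(t)},y-y^{(t)}\rangle$. *)

theory Defs
  imports "HOL-Analysis.Analysis"
begin

section \<open>Extreme eigenvalues and the spectral norm\<close>

definition eigenvalues :: "real^'n^'n \<Rightarrow> real set" where
  "eigenvalues M = {k. \<exists>v. v \<noteq> 0 \<and> M *v v = k *\<^sub>R v}"

text \<open>
  The following two are meaningful for symmetric \<open>M\<close>, whose set of real eigenvalues is finite
  and nonempty (\<open>finite_eigenvalues\<close>, \<open>eigenvalues_nonempty\<close> below).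
\<close>

definition lambda_min :: "real^'n^'n \<Rightarrow> real" where
  "lambda_min M = Min (eigenvalues M)"

definition lambda_max :: "real^'n^'n \<Rightarrow> real" where
  "lambda_max M = Max (eigenvalues M)"

definition spectral_norm :: "real^'d^'n \<Rightarrow> real" where
  "spectral_norm A = onorm ((*v) A)"

lemma symmetric_inner:
  fixes M :: "real^'n^'n"
  assumes "transpose M = M"
  shows "(M *v x) \<bullet> y = x \<bullet> (M *v y)"
  by (metis assms dot_lmul_matrix transpose_matrix_vector)

lemma finite_eigenvalues:
  fixes M :: "real^'n^'n"
  assumes sym: "transpose M = M"
  shows "finite (eigenvalues M)"
proof -
  obtain e where e: "\<And>k. k \<in> eigenvalues M \<Longrightarrow> e k \<noteq> 0 \<and> M *v e k = k *\<^sub>R e k"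
  proof -
    have "\<forall>k. \<exists>v. k \<in> eigenvalues M \<longrightarrow> v \<noteq> 0 \<and> M *v v = k *\<^sub>R v"
      unfolding eigenvalues_def by auto
    then show thesis using that by metis
  qed
  have orth: "e k \<bullet> e l = 0" if "k \<in> eigenvalues M" "l \<in> eigenvalues M" "k \<noteq> l" for k l
  proof -
    have "k * (e k \<bullet> e l) = l * (e k \<bullet> e l)"
      using symmetric_inner[OF sym, of "e k" "e l"] e that by simp
    then show ?thesis using that by simp
  qed
  have inj: "inj_on e (eigenvalues M)"
    by (rule inj_onI) (metis e inner_eq_zero_iff orth)
  have "pairwise orthogonal (e ` eigenvalues M)"
    unfolding pairwise_def orthogonal_def using orth by auto
  then have "independent (e ` eigenvalues M)"
    using e by (intro pairwise_orthogonal_independent) auto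
  then have "finite (e ` eigenvalues M)"
    by (rule independent_imp_finite)
  then show ?thesis
    using inj finite_imageD by blast
qed

lemma rayleigh_max:
  fixes M :: "real^'n^'n"
  assumes sym: "transpose M = M"
  obtains v m where "norm v = 1" "M *v v = m *\<^sub>R v" "\<And>x. x \<bullet> (M *v x) \<le> m * (norm x)\<^sup>2"
proof -
  have cont: "continuous_on (sphere 0 1) (\<lambda>x. x \<bullet> (M *v x))"
    by (intro continuous_intros linear_continuous_on linear_conv_bounded_linear[THEN iffD1]) simp
  have "sphere (0::real^'n) 1 \<noteq> {}" by simp
  then obtain v where v: "v \<in> sphere 0 1"
    and vmax: "\<And>x. x \<in> sphere 0 1 \<Longrightarrow> x \<bullet> (M *v x) \<le> v \<bullet> (M *v v)"
    using continuous_attains_sup[OF compact_sphere _ cont] by blast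
  define m where "m = v \<bullet> (M *v v)"
  have nv: "norm v = 1" using v by simp
  have bound: "x \<bullet> (M *v x) \<le> m * (norm x)\<^sup>2" for x
  proof (cases "x = 0")
    case False
    have "(inverse (norm x) *\<^sub>R x) \<bullet> (M *v (inverse (norm x) *\<^sub>R x)) \<le> m"
      unfolding m_def using False by (intro vmax) simp
    then have "(x \<bullet> (M *v x)) / (norm x)\<^sup>2 \<le> m"
      by (simp add: matrix_vector_mult_scaleR power2_eq_square field_simps)
    then show ?thesis using False by (simp add: divide_le_eq)
  qed simp
  define r where "r = m *\<^sub>R v - M *v v"
  define c where "c = m * (norm r)\<^sup>2 - r \<bullet> (M *v r)"
  have c0: "c \<ge> 0" using bound[of r] by (simp add: c_def)
  have key: "0 \<le> s\<^sup>2 * c - 2 * s * (r \<bullet> r)" for s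
  proof -
    have "0 \<le> m * (norm (v - s *\<^sub>R r))\<^sup>2 - (v - s *\<^sub>R r) \<bullet> (M *v (v - s *\<^sub>R r))"
      using bound by simp
    also have "(norm (v - s *\<^sub>R r))\<^sup>2 = v \<bullet> v - 2 * s * (r \<bullet> v) + s * s * (norm r)\<^sup>2"
      unfolding power2_norm_eq_inner by (simp add: algebra_simps inner_commute)
    also have "m * \<dots> - (v - s *\<^sub>R r) \<bullet> (M *v (v - s *\<^sub>R r))
        = m * (v \<bullet> v) - v \<bullet> (M *v v) + s\<^sup>2 * c
        - s * (2 * m * (r \<bullet> v) - r \<bullet> (M *v v) - v \<bullet> (M *v r))"
      by (simp add: c_def matrix_vector_mult_diff_distrib matrix_vector_mult_scaleR
          power2_eq_square[of s] algebra_simps)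
    also have "v \<bullet> (M *v r) = r \<bullet> (M *v v)"
      using symmetric_inner[OF sym, of v r] by (simp add: inner_commute)
    also have "m * (v \<bullet> v) - v \<bullet> (M *v v) = 0"
      using nv by (simp add: m_def flip: power2_norm_eq_inner)
    also have "2 * m * (r \<bullet> v) - r \<bullet> (M *v v) - r \<bullet> (M *v v) = 2 * (r \<bullet> r)"
      by (subst (4) r_def) (simp add: inner_diff_right)
    finally show ?thesis by simp
  qed
  have "r \<bullet> r \<le> 0"
  proof (rule ccontr)
    assume "\<not> r \<bullet> r \<le> 0"
    then have pos: "r \<bullet> r > 0" by linarith
    define s where "s = (r \<bullet> r) / (c + 1)"
    have "s > 0" using pos c0 by (simp add: s_def)
    have "s * (2 * (r \<bullet> r)) \<le> s * (s * c)"
      using key[of s] by (simp add: power2_eq_square mult_ac)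
    then have "2 * (r \<bullet> r) \<le> s * c"
      using \<open>s > 0\<close> by (meson mult_le_cancel_left_pos)
    also have "\<dots> = (r \<bullet> r) * (c / (c + 1))"
      by (simp add: s_def)
    also have "\<dots> \<le> (r \<bullet> r) * 1"
      using pos c0 by (intro mult_left_mono) auto
    finally show False using pos by simp
  qed
  then have "r = 0"
    by (metis inner_ge_zero inner_eq_zero_iff order_antisym)
  then have "M *v v = m *\<^sub>R v"
    unfolding r_def by simp
  then show thesis using that nv bound by blast
qed

lemma eigenvalues_nonempty:
  fixes M :: "real^'n^'n"
  assumes "transpose M = M"
  shows "eigenvalues M \<noteq> {}"
proof -
  obtain v m where "norm v = 1" "M *v v = m *\<^sub>R v"
    using rayleigh_max[OF assms] by blast
  then have "m \<in> eigenvalues M"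
    unfolding eigenvalues_def mem_Collect_eq by (metis norm_zero zero_neq_one)
  then show ?thesis by blast
qed

lemma spectral_norm_eq_sqrt_lambda_max:
  fixes A :: "real^'d^'n"
  shows "spectral_norm A = sqrt (lambda_max (transpose A ** A))"
proof -
  let ?M = "transpose A ** A"
  have sym: "transpose ?M = ?M"
    by (simp only: matrix_transpose_mul transpose_transpose)
  have quad: "x \<bullet> (?M *v x) = (norm (A *v x))\<^sup>2" for x
  proof -
    have "x \<bullet> (?M *v x) = (transpose A *v (A *v x)) \<bullet> x"
      by (metis inner_commute matrix_vector_mul_assoc)
    also have "\<dots> = (A *v x) \<bullet> (A *v x)"
      by (metis dot_lmul_matrix transpose_matrix_vector)
    finally show ?thesis by (simp add: power2_norm_eq_inner)
  qed
  obtain v m where v: "norm v = 1" "?M *v v = m *\<^sub>R v"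
    and bound: "\<And>x. x \<bullet> (?M *v x) \<le> m * (norm x)\<^sup>2"
    using rayleigh_max[OF sym] by blast
  have m: "m = (norm (A *v v))\<^sup>2"
    using quad[of v] v by (simp add: dot_square_norm)
  have "m \<in> eigenvalues ?M"
    unfolding eigenvalues_def mem_Collect_eq using v by (metis norm_zero zero_neq_one)
  moreover have "k \<le> m" if k: "k \<in> eigenvalues ?M" for k
  proof -
    obtain w where w: "w \<noteq> 0" "?M *v w = k *\<^sub>R w"
      using k unfolding eigenvalues_def by blast
    then have "k * (norm w)\<^sup>2 \<le> m * (norm w)\<^sup>2"
      using bound[of w] by (simp add: dot_square_norm)
    then show ?thesis using \<open>w \<noteq> 0\<close> by simp
  qed
  ultimately have "lambda_max ?M = m"
    unfolding lambda_max_def using finite_eigenvalues[OF sym] by (meson Max_eqI)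
  moreover have "onorm ((*v) A) = norm (A *v v)"
  proof (rule antisym)
    show "onorm ((*v) A) \<le> norm (A *v v)"
    proof (rule onorm_bound)
      fix x
      have "(norm (A *v x))\<^sup>2 \<le> (norm (A *v v) * norm x)\<^sup>2"
        using bound[of x] quad[of x] m by (simp add: power_mult_distrib)
      then show "norm (A *v x) \<le> norm (A *v v) * norm x"
        by (rule power2_le_imp_le) simp
    qed simp
    show "norm (A *v v) \<le> onorm ((*v) A)"
      using onorm[OF matrix_vector_mul_bounded_linear, of A v] v by simp
  qed
  ultimately show ?thesis
    by (simp add: spectral_norm_def m)
qed


section \<open>Strong convexity, smoothness, proximal operator\<close>

definition strongly_convex :: "real \<Rightarrow> ('a::real_inner \<Rightarrow> real) \<Rightarrow> bool" where
  "strongly_convex \<nu> \<phi> \<longleftrightarrow> convex_on UNIV (\<lambda>z. \<phi> z - \<nu> / 2 * (norm z)\<^sup>2)"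

definition smooth :: "real \<Rightarrow> ('a::real_inner \<Rightarrow> real) \<Rightarrow> bool" where
  "smooth K \<phi> \<longleftrightarrow> (\<exists>\<phi>'. (\<forall>z. GDERIV \<phi> z :> \<phi>' z) \<and> K-lipschitz_on UNIV \<phi>')"

definition prox :: "real \<Rightarrow> ('a::real_inner \<Rightarrow> real) \<Rightarrow> 'a \<Rightarrow> 'a" where
  "prox s \<psi> z = arg_min (\<lambda>x. s * \<psi> x + 1 / 2 * (norm (x - z))\<^sup>2) (\<lambda>_. True)"


section \<open>Conjugate, Bregman divergence, Lagrangian\<close>

text \<open>
  The conjugate of a finite function can take the value \<open>\<infinity>\<close>, so it and everything
  built from it is \<open>ereal\<close>-valued.
\<close>

definition conjugate :: "('a::real_inner \<Rightarrow> real) \<Rightarrow> 'a \<Rightarrow> ereal" where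
  "conjugate f y = (SUP z. ereal (y \<bullet> z - f z))"

text \<open>
  Differentiability of an extended-valued function at a point: it is finite in a
  neighbourhood of the point and differentiable there as a real function.
\<close>

definition has_gradient_ereal :: "('a::real_inner \<Rightarrow> ereal) \<Rightarrow> 'a \<Rightarrow> 'a \<Rightarrow> bool" where
  "has_gradient_ereal F y v \<longleftrightarrow>
     (\<forall>\<^sub>F u in nhds y. \<bar>F u\<bar> \<noteq> \<infinity>) \<and> GDERIV (\<lambda>u. real_of_ereal (F u)) y :> v"

text \<open>
  Bregman divergence with kernel \<open>F\<close>, where the vector \<open>v\<close> represents the gradient of \<open>F\<close>
  at \<open>y'\<close>.
\<close>

definition bregman :: "('a::real_inner \<Rightarrow> ereal) \<Rightarrow> 'a \<Rightarrow> 'a \<Rightarrow> 'a \<Rightarrow> ereal" where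
  "bregman F v y y' = F y - F y' - ereal (v \<bullet> (y - y'))"

definition lagrangian ::
  "real^'d^'n \<Rightarrow> (real^'n \<Rightarrow> real) \<Rightarrow> (real^'d \<Rightarrow> real) \<Rightarrow> real^'d \<Rightarrow> real^'n \<Rightarrow> ereal" where
  "lagrangian A f g x y = ereal (g x + y \<bullet> (A *v x)) - conjugate f y"

definition saddle_point :: "('a \<Rightarrow> 'b \<Rightarrow> ereal) \<Rightarrow> 'a \<times> 'b \<Rightarrow> bool" where
  "saddle_point K p \<longleftrightarrow> (\<forall>x y. K (fst p) y \<le> K (fst p) (snd p) \<and> K (fst p) (snd p) \<le> K x (snd p))"


section \<open>The Dual-Free BPD iteration\<close>

definition dual_free_bpd ::
  "real^'d^'n \<Rightarrow> (real^'n \<Rightarrow> real) \<Rightarrow> (real^'d \<Rightarrow> real) \<Rightarrow> real \<Rightarrow> real \<Rightarrow> real \<Rightarrow>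
   (nat \<Rightarrow> real^'d) \<Rightarrow> (nat \<Rightarrow> real^'d) \<Rightarrow> (nat \<Rightarrow> real^'n) \<Rightarrow> (nat \<Rightarrow> real^'n) \<Rightarrow> bool" where
  "dual_free_bpd A f g \<sigma> \<tau> \<theta> x xt v y \<longleftrightarrow>
     xt 0 = x 0 \<and>
     has_gradient_ereal (conjugate f) (y 0) (v 0) \<and>
     (\<forall>t. v (Suc t) = (1 / (1 + \<sigma>)) *\<^sub>R (v t + \<sigma> *\<^sub>R (A *v xt t)) \<and>
          GDERIV f (v (Suc t)) :> y (Suc t) \<and>
          x (Suc t) = prox \<tau> g (x t - \<tau> *\<^sub>R (transpose A *v y (Suc t))) \<and>
          xt (Suc t) = x (Suc t) + \<theta> *\<^sub>R (x (Suc t) - x t))"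

end

theory Submission
  imports Defs
begin

text \<open>
  At every iterate \<open>y\<^sub>t\<close> is the gradient of \<open>f\<close> at \<open>v\<^sub>t\<close>; for \<open>t = 0\<close> this follows from convexity of the
  conjugate. Hence the divergence of \<open>y\<^sub>t\<close> from the dual solution is the real number
  \<open>f v\<^sub>t - f (A x) - \<langle>y, v\<^sub>t - A x\<rangle>\<close>, where \<open>(x, y)\<close> is the saddle point, and the conjugate
  disappears from the analysis.

  The quantity that contracts is the constant \<open>C\<close> with \<open>(x\<^sub>0, y\<^sub>0)\<close> replaced by \<open>(x\<^sub>t, y\<^sub>t)\<close>, minus
  the coupling term \<open>\<langle>y - y\<^sub>t, A (x\<^sub>t - x\<^sub>t\<^sub>-\<^sub>1)\<rangle>\<close>, plus \<open>1 / (2\<tau>)\<close> times the squared norm of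
  \<open>x\<^sub>t - x\<^sub>t\<^sub>-\<^sub>1\<close>. In one step, half of the
  divergence between consecutive dual iterates absorbs the coupling. The other half, with half of
  the divergence to the dual solution, controls \<open>A (x - x\<^sub>t)\<close> through the strong convexity
  of \<open>f\<close>; this is where the data matrix contributes to the primal contraction.
\<close>

section \<open>Strong convexity and smoothness\<close>

text \<open>The chord bound caps every forward difference quotient along the segment from
  \<open>z\<close> to \<open>w\<close> by \<open>h w - h z\<close>, and the cap survives the limit.
  Asking only for chords towards one \<open>w\<close> lets the lemma serve the real part of the
  conjugate, which need not be convex on the whole space.\<close>

lemma gderiv_le_of_chord:
  fixes h :: "'a::real_inner \<Rightarrow> real"
  assumes d: "GDERIV h z :> d"
    and chord: "\<And>s. 0 < s \<Longrightarrow> s \<le> 1 \<Longrightarrow> h (z + s *\<^sub>R (w - z)) \<le> (1 - s) * h z + s * h w"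
  shows "h z + d \<bullet> (w - z) \<le> h w"
proof -
  have "((\<lambda>s. z + s *\<^sub>R (w - z)) has_derivative (\<lambda>s. s *\<^sub>R (w - z))) (at 0)"
    by (auto intro!: derivative_eq_intros)
  from has_derivative_compose[OF this, of h "\<lambda>u. u \<bullet> d"] d
  have "((\<lambda>s. h (z + s *\<^sub>R (w - z))) has_derivative (\<lambda>s. (s *\<^sub>R (w - z)) \<bullet> d)) (at 0)"
    by (simp add: gderiv_def)
  then have "((\<lambda>s. h (z + s *\<^sub>R (w - z))) has_real_derivative (w - z) \<bullet> d) (at 0)"
    by (simp add: has_field_derivative_def mult.commute[of _ "(w - z) \<bullet> d"])
  then have "((\<lambda>s. (h (z + s *\<^sub>R (w - z)) - h z) / s) \<longlongrightarrow> (w - z) \<bullet> d) (at 0)"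
    by (simp add: has_field_derivative_iff)
  then have lim: "((\<lambda>s. (h (z + s *\<^sub>R (w - z)) - h z) / s) \<longlongrightarrow> (w - z) \<bullet> d) (at_right 0)"
    using filterlim_at_split by blast
  have "\<forall>\<^sub>F s in at_right 0. (h (z + s *\<^sub>R (w - z)) - h z) / s \<le> h w - h z"
  proof (rule eventually_at_rightI[of 0 1])
    fix s :: real assume "s \<in> {0<..<1}"
    then show "(h (z + s *\<^sub>R (w - z)) - h z) / s \<le> h w - h z"
      using chord[of s] by (simp add: pos_divide_le_eq left_diff_distrib right_diff_distrib mult.commute)
  qed simp
  then have "(w - z) \<bullet> d \<le> h w - h z"
    by (intro tendsto_upperbound[OF lim]) auto
  then show ?thesis by (simp add: inner_commute)
qed

lemma convex_gderiv_le:
  fixes f :: "'a::real_inner \<Rightarrow> real"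
  assumes "convex_on UNIV f" and "GDERIV f z :> d"
  shows "f z + d \<bullet> (w - z) \<le> f w"
proof (rule gderiv_le_of_chord[OF assms(2)])
  fix s :: real assume "0 < s" "s \<le> 1"
  then have "f ((1 - s) *\<^sub>R z + s *\<^sub>R w) \<le> (1 - s) * f z + s * f w"
    by (intro convex_onD[OF assms(1)]) auto
  then show "f (z + s *\<^sub>R (w - z)) \<le> (1 - s) * f z + s * f w"
    by (simp add: algebra_simps)
qed

lemma gderiv_unique:
  fixes f :: "'a::real_inner \<Rightarrow> real"
  assumes "GDERIV f z :> d" and "GDERIV f z :> e"
  shows "d = e"
proof -
  have "(\<lambda>h. h \<bullet> d) = (\<lambda>h. h \<bullet> e)"
    using assms unfolding gderiv_def by (rule has_derivative_unique)
  then show ?thesis by (metis vector_eq_ldot)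
qed

lemma gderiv_minimum_zero:
  fixes h :: "'a::real_inner \<Rightarrow> real"
  assumes "GDERIV h z :> d" and "\<And>w. h z \<le> h w"
  shows "d = 0"
proof -
  have "(\<lambda>u. u \<bullet> d) = (\<lambda>u. 0)"
    using assms by (intro differential_zero_maxmin[of z UNIV h]) (auto simp: gderiv_def)
  then have "d \<bullet> d = 0" by meson
  then show ?thesis by simp
qed

lemma norm_convex_combination:
  fixes x y :: "'a::real_inner"
  shows "(norm ((1 - s) *\<^sub>R x + s *\<^sub>R y))\<^sup>2
    = (1 - s) * (norm x)\<^sup>2 + s * (norm y)\<^sup>2 - s * (1 - s) * (norm (y - x))\<^sup>2"
  unfolding power2_norm_eq_inner
  by (simp add: inner_add inner_diff algebra_simps inner_commute power2_eq_square)

text \<open>By \<open>norm_convex_combination\<close>, the quadratic shifts the two sides of the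
  convexity inequality by amounts that differ exactly by the defect term, so the equivalence holds
  for each \<open>x\<close>, \<open>y\<close>, \<open>s\<close> separately.\<close>

lemma strongly_convex_iff:
  fixes \<phi> :: "'a::real_inner \<Rightarrow> real"
  shows "strongly_convex \<nu> \<phi> \<longleftrightarrow>
    (\<forall>x y s. 0 \<le> s \<longrightarrow> s \<le> 1 \<longrightarrow> \<phi> ((1 - s) *\<^sub>R x + s *\<^sub>R y)
       \<le> (1 - s) * \<phi> x + s * \<phi> y - \<nu> / 2 * (s * (1 - s)) * (norm (y - x))\<^sup>2)"
    (is "?L \<longleftrightarrow> ?R")
proof -
  define \<psi> where "\<psi> = (\<lambda>z. \<phi> z - \<nu> / 2 * (norm z)\<^sup>2)"
  have eq: "\<psi> ((1 - s) *\<^sub>R x + s *\<^sub>R y) \<le> (1 - s) * \<psi> x + s * \<psi> y \<longleftrightarrow>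
     \<phi> ((1 - s) *\<^sub>R x + s *\<^sub>R y)
       \<le> (1 - s) * \<phi> x + s * \<phi> y - \<nu> / 2 * (s * (1 - s)) * (norm (y - x))\<^sup>2" for x y s
  proof -
    have "\<psi> ((1 - s) *\<^sub>R x + s *\<^sub>R y) - ((1 - s) * \<psi> x + s * \<psi> y)
      = \<phi> ((1 - s) *\<^sub>R x + s *\<^sub>R y) - ((1 - s) * \<phi> x + s * \<phi> y
          - \<nu> / 2 * (s * (1 - s)) * (norm (y - x))\<^sup>2)"
      unfolding \<psi>_def norm_convex_combination by algebra
    then show ?thesis by linarith
  qed
  have "convex_on UNIV \<psi> \<longleftrightarrow>
     (\<forall>x y s. 0 \<le> s \<longrightarrow> s \<le> 1 \<longrightarrow> \<psi> ((1 - s) *\<^sub>R x + s *\<^sub>R y) \<le> (1 - s) * \<psi> x + s * \<psi> y)"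
  proof
    assume "convex_on UNIV \<psi>"
    then show "\<forall>x y s. 0 \<le> s \<longrightarrow> s \<le> 1 \<longrightarrow>
        \<psi> ((1 - s) *\<^sub>R x + s *\<^sub>R y) \<le> (1 - s) * \<psi> x + s * \<psi> y"
      by (auto intro: convex_onD)
  next
    assume r: "\<forall>x y s. 0 \<le> s \<longrightarrow> s \<le> 1 \<longrightarrow>
        \<psi> ((1 - s) *\<^sub>R x + s *\<^sub>R y) \<le> (1 - s) * \<psi> x + s * \<psi> y"
    show "convex_on UNIV \<psi>"
      using r by (intro convex_onI) auto
  qed
  then show ?thesis
    unfolding strongly_convex_def \<psi>_def[symmetric] eq .
qed

text \<open>The tangent inequality is applied to \<open>\<phi>\<close> minus its quadratic, which
  has gradient \<open>d - \<nu> *\<^sub>R z\<close> at \<open>z\<close>; the quadratic terms then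
  combine to the square of \<open>w - z\<close>.\<close>

lemma strongly_convex_gderiv_ge:
  fixes \<phi> :: "'a::real_inner \<Rightarrow> real"
  assumes "strongly_convex \<nu> \<phi>" and "GDERIV \<phi> z :> d"
  shows "\<phi> z + d \<bullet> (w - z) + \<nu> / 2 * (norm (w - z))\<^sup>2 \<le> \<phi> w"
proof -
  have "((\<lambda>z. \<phi> z - \<nu> / 2 * (z \<bullet> z)) has_derivative (\<lambda>h. h \<bullet> (d - \<nu> *\<^sub>R z))) (at z)"
    using assms(2) unfolding gderiv_def
    by (auto intro!: derivative_eq_intros simp: fun_eq_iff algebra_simps inner_commute)
  then have "GDERIV (\<lambda>z. \<phi> z - \<nu> / 2 * (norm z)\<^sup>2) z :> d - \<nu> *\<^sub>R z"
    by (simp add: gderiv_def power2_norm_eq_inner)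
  from convex_gderiv_le[OF assms(1)[unfolded strongly_convex_def] this, of w]
  have "\<phi> z - \<nu> / 2 * (z \<bullet> z) + (d - \<nu> *\<^sub>R z) \<bullet> (w - z) \<le> \<phi> w - \<nu> / 2 * (w \<bullet> w)"
    by (simp add: power2_norm_eq_inner)
  then show ?thesis
    unfolding power2_norm_eq_inner by (simp add: algebra_simps inner_commute)
qed

section \<open>Minimisers of strongly convex functions and the proximal step\<close>

lemma nonneg_of_le_small_multiples:
  fixes a b :: real
  assumes "\<And>s. 0 < s \<Longrightarrow> s \<le> 1 \<Longrightarrow> 0 \<le> a + s * b"
  shows "0 \<le> a"
proof -
  have "((\<lambda>s. a + s * b) \<longlongrightarrow> a + 0 * b) (at_right 0)"
    by (intro tendsto_intros)
  moreover have "\<forall>\<^sub>F s in at_right 0. 0 \<le> a + s * b"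
    using assms by (intro eventually_at_rightI[of 0 1]) auto
  ultimately show ?thesis
    using tendsto_lowerbound[of "\<lambda>s. a + s * b" a "at_right 0" 0] by simp
qed

text \<open>The minimum is compared with the value a fraction \<open>s\<close> of the way to
  \<open>w\<close>. Dividing by \<open>s\<close> and letting \<open>s\<close> tend to 0 recovers the
  full modulus; no derivative is taken, so a nonsmooth \<open>g\<close> is covered.\<close>

lemma strongly_convex_growth:
  fixes \<phi> :: "'a::real_inner \<Rightarrow> real"
  assumes "strongly_convex \<nu> \<phi>" and min: "\<And>w. \<phi> x \<le> \<phi> w"
  shows "\<phi> x + \<nu> / 2 * (norm (w - x))\<^sup>2 \<le> \<phi> w"
proof -
  have "0 \<le> (\<phi> w - \<phi> x - \<nu> / 2 * (norm (w - x))\<^sup>2) + s * (\<nu> / 2 * (norm (w - x))\<^sup>2)"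
    if s: "0 < s" "s \<le> 1" for s
  proof -
    have "\<phi> x \<le> (1 - s) * \<phi> x + s * \<phi> w - \<nu> / 2 * (s * (1 - s)) * (norm (w - x))\<^sup>2"
      using assms(1) s min[of "(1 - s) *\<^sub>R x + s *\<^sub>R w"] unfolding strongly_convex_iff
      by (meson less_imp_le order_trans)
    moreover have "s * ((\<phi> w - \<phi> x - \<nu> / 2 * (norm (w - x))\<^sup>2) + s * (\<nu> / 2 * (norm (w - x))\<^sup>2))
      = ((1 - s) * \<phi> x + s * \<phi> w - \<nu> / 2 * (s * (1 - s)) * (norm (w - x))\<^sup>2) - \<phi> x"
      by (simp add: field_simps)
    ultimately have "0 \<le> s * ((\<phi> w - \<phi> x - \<nu> / 2 * (norm (w - x))\<^sup>2) + s * (\<nu> / 2 * (norm (w - x))\<^sup>2))"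
      by linarith
    then show ?thesis using s by (simp add: zero_le_mult_iff)
  qed
  from nonneg_of_le_small_multiples[OF this] show ?thesis by simp
qed

lemma strongly_convex_imp_convex:
  fixes \<phi> :: "'a::real_inner \<Rightarrow> real"
  assumes "strongly_convex \<nu> \<phi>" and "\<nu> \<ge> 0"
  shows "convex_on UNIV \<phi>"
proof (rule convex_onI)
  fix s and x y :: 'a assume s: "0 < s" "s < (1::real)"
  have "\<phi> ((1 - s) *\<^sub>R x + s *\<^sub>R y)
      \<le> (1 - s) * \<phi> x + s * \<phi> y - \<nu> / 2 * (s * (1 - s)) * (norm (y - x))\<^sup>2"
    using assms(1) s unfolding strongly_convex_iff by simp
  moreover have "0 \<le> \<nu> / 2 * (s * (1 - s)) * (norm (y - x))\<^sup>2"
    using s assms(2) by simp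
  ultimately show "\<phi> ((1 - s) *\<^sub>R x + s *\<^sub>R y) \<le> (1 - s) * \<phi> x + s * \<phi> y"
    by linarith
qed simp

text \<open>The convex remainder \<open>k\<close> is bounded on the unit ball, hence decreases at
  most linearly along rays, and the quadratic wins far out. A minimiser over a large ball is
  therefore global.\<close>

lemma strongly_convex_attains_min:
  fixes \<phi> :: "'a::euclidean_space \<Rightarrow> real"
  assumes sc: "strongly_convex \<nu> \<phi>" and "\<nu> > 0"
  obtains x where "\<And>w. \<phi> x \<le> \<phi> w"
proof -
  define k where "k = (\<lambda>z. \<phi> z - \<nu> / 2 * (norm z)\<^sup>2)"
  have kc: "convex_on UNIV k"
    using sc unfolding strongly_convex_def k_def .
  have cont_k: "continuous_on UNIV k"
    by (rule convex_on_continuous[OF open_UNIV kc])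
  have "\<phi> = (\<lambda>z. k z + \<nu> / 2 * (norm z)\<^sup>2)" by (simp add: k_def)
  then have cont: "continuous_on UNIV \<phi>"
    using cont_k by (auto intro!: continuous_intros)
  have "bounded (k ` cball 0 1)"
    by (intro compact_imp_bounded compact_continuous_image continuous_on_subset[OF cont_k]) auto
  then obtain M where "\<forall>z\<in>k ` cball 0 1. norm z \<le> M"
    unfolding bounded_iff by blast
  then have M: "\<bar>k z\<bar> \<le> M" if "norm z \<le> 1" for z
    using that by auto
  have M0: "M \<ge> 0" using M[of 0] by simp
  \<comment> \<open>Convexity is used on the segment from 0 to \<open>x\<close>, at its point of
    norm 1, where \<open>k\<close> is at least \<open>- M\<close>.\<close>
  have lower: "- 2 * M * norm x \<le> k x" if "norm x \<ge> 1" for x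
  proof -
    have x: "norm x > 0" using that by linarith
    have "k ((1 - 1 / norm x) *\<^sub>R 0 + (1 / norm x) *\<^sub>R x)
        \<le> (1 - 1 / norm x) * k 0 + (1 / norm x) * k x"
      using that x by (intro convex_onD[OF kc]) auto
    moreover have "- M \<le> k ((1 / norm x) *\<^sub>R x)"
      using M[of "(1 / norm x) *\<^sub>R x"] x by simp
    moreover have "(1 - 1 / norm x) * k 0 \<le> (1 - 1 / norm x) * M"
      using M[of 0] that x by (intro mult_left_mono) (auto simp: abs_le_iff)
    moreover have "(1 - 1 / norm x) * M \<le> 1 * M"
      using M0 x by (intro mult_right_mono) auto
    ultimately have "- 2 * M \<le> k x / norm x" by simp
    then show ?thesis using x by (simp add: le_divide_eq)
  qed
  \<comment> \<open>Beyond \<open>6 * M / \<nu>\<close> the quadratic is at least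
    \<open>3 * M * norm x\<close>: two thirds offset the bound \<open>lower\<close>, and the rest
    dominates \<open>\<phi> 0\<close>, which is at most \<open>M\<close>.\<close>
  define R where "R = max 1 (6 * M / \<nu>)"
  have out: "\<phi> 0 \<le> \<phi> x" if "norm x \<ge> R" for x
  proof -
    have x1: "norm x \<ge> 1" and x2: "norm x \<ge> 6 * M / \<nu>" using that by (auto simp: R_def)
    have "3 * M \<le> \<nu> / 2 * norm x"
      using x2 \<open>\<nu> > 0\<close> by (simp add: divide_le_eq mult.commute)
    then have "3 * M * norm x \<le> \<nu> / 2 * norm x * norm x"
      by (rule mult_right_mono) simp
    moreover have "M * 1 \<le> M * norm x"
      using x1 M0 by (rule mult_left_mono)
    moreover have "\<phi> 0 \<le> M" using M[of 0] by (simp add: k_def)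
    moreover have "\<phi> x = k x + \<nu> / 2 * norm x * norm x"
      by (simp add: k_def power2_eq_square)
    ultimately show ?thesis using lower[OF x1] by linarith
  qed
  have "R \<ge> 1" by (simp add: R_def)
  then have "cball (0::'a) R \<noteq> {}" by simp
  then obtain x where x: "x \<in> cball 0 R" "\<And>w. w \<in> cball 0 R \<Longrightarrow> \<phi> x \<le> \<phi> w"
    using continuous_attains_inf[OF compact_cball _ continuous_on_subset[OF cont], of 0 R] by blast
  have "\<phi> x \<le> \<phi> w" for w
  proof (cases "norm w \<le> R")
    case True
    then show ?thesis using x(2) by simp
  next
    case False
    then have "\<phi> 0 \<le> \<phi> w" using out by simp
    moreover have "\<phi> x \<le> \<phi> 0" using x(2) \<open>R \<ge> 1\<close> by simp
    ultimately show ?thesis by linarith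
  qed
  then show thesis by (rule that)
qed

lemma strongly_convex_add:
  fixes \<phi> \<psi> :: "'a::real_inner \<Rightarrow> real"
  assumes "strongly_convex a \<phi>" and "strongly_convex b \<psi>"
  shows "strongly_convex (a + b) (\<lambda>z. \<phi> z + \<psi> z)"
proof -
  have "(\<lambda>z. \<phi> z + \<psi> z - (a + b) / 2 * (norm z)\<^sup>2)
      = (\<lambda>z. (\<phi> z - a / 2 * (norm z)\<^sup>2) + (\<psi> z - b / 2 * (norm z)\<^sup>2))"
    by (auto simp: fun_eq_iff algebra_simps add_divide_distrib)
  then show ?thesis
    using assms convex_on_add unfolding strongly_convex_def by auto
qed

lemma strongly_convex_sq_dist:
  fixes z :: "'a::real_inner"
  shows "strongly_convex \<nu> (\<lambda>x. \<nu> / 2 * (norm (x - z))\<^sup>2)"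
proof -
  have "(1 - s) *\<^sub>R x + s *\<^sub>R y - z = (1 - s) *\<^sub>R (x - z) + s *\<^sub>R (y - z)"
    for x y :: 'a and s :: real
    by (simp add: algebra_simps)
  then show ?thesis
    unfolding strongly_convex_iff
    by (simp add: norm_convex_combination) (simp add: algebra_simps)
qed

text \<open>The defect of \<open>f\<close> is measured by the norm of \<open>A *v (y - x)\<close>,
  which \<open>lower\<close> bounds from below. With \<open>m\<close> equal to
  \<open>\<mu>\<^sup>2\<close> this makes the primal objective strongly convex even when
  \<open>g\<close> is merely convex.\<close>

lemma strongly_convex_compose_matrix:
  fixes A :: "real^'d^'n" and f :: "real^'n \<Rightarrow> real"
  assumes sc: "strongly_convex \<delta> f" and "\<delta> \<ge> 0"
    and lower: "\<And>x. m * (norm x)\<^sup>2 \<le> (norm (A *v x))\<^sup>2"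
  shows "strongly_convex (\<delta> * m) (\<lambda>x. f (A *v x))"
  unfolding strongly_convex_iff
proof (intro allI impI)
  fix x y :: "real^'d" and s :: real assume s: "0 \<le> s" "s \<le> 1"
  have "f ((1 - s) *\<^sub>R (A *v x) + s *\<^sub>R (A *v y))
     \<le> (1 - s) * f (A *v x) + s * f (A *v y)
       - \<delta> / 2 * (s * (1 - s)) * (norm (A *v y - A *v x))\<^sup>2"
    using sc s unfolding strongly_convex_iff by blast
  moreover have "\<delta> / 2 * (s * (1 - s)) * (m * (norm (y - x))\<^sup>2)
      \<le> \<delta> / 2 * (s * (1 - s)) * (norm (A *v y - A *v x))\<^sup>2"
    using lower[of "y - x"] s assms(2)
    by (intro mult_left_mono) (auto simp: matrix_vector_mult_diff_distrib)
  ultimately show "f (A *v ((1 - s) *\<^sub>R x + s *\<^sub>R y))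
     \<le> (1 - s) * f (A *v x) + s * f (A *v y)
       - \<delta> * m / 2 * (s * (1 - s)) * (norm (y - x))\<^sup>2"
    by (simp add: matrix_vector_right_distrib matrix_vector_mult_scaleR mult.commute mult.left_commute)
qed

text \<open>The proximal objective divided by \<open>s\<close> is strongly convex with modulus
  \<open>l + 1 / s\<close>, and the claim is its quadratic growth at the minimiser.\<close>

lemma prox_three_point:
  fixes g :: "'a::euclidean_space \<Rightarrow> real"
  assumes sc: "strongly_convex l g" and "l \<ge> 0" and "s > 0"
  shows "g (prox s g z) + 1 / (2 * s) * (norm (prox s g z - z))\<^sup>2
      + (l / 2 + 1 / (2 * s)) * (norm (w - prox s g z))\<^sup>2
    \<le> g w + 1 / (2 * s) * (norm (w - z))\<^sup>2"
proof -
  define \<phi> where "\<phi> = (\<lambda>x. g x + (1 / s) / 2 * (norm (x - z))\<^sup>2)"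
  have \<phi>: "strongly_convex (l + 1 / s) \<phi>"
    unfolding \<phi>_def by (intro strongly_convex_add sc strongly_convex_sq_dist)
  have "l + 1 / s > 0" using assms by (simp add: add_nonneg_pos)
  then obtain p where p: "\<And>w. \<phi> p \<le> \<phi> w"
    using strongly_convex_attains_min[OF \<phi>] by blast
  have resc: "s * g x + 1 / 2 * (norm (x - z))\<^sup>2 = s * \<phi> x" for x
    using \<open>s > 0\<close> by (simp add: \<phi>_def field_simps)
  \<comment> \<open>\<open>arg_min\<close> is a choice operator, so the existing minimiser
    \<open>p\<close> is what makes \<open>prox\<close> a minimiser.\<close>
  have "is_arg_min (\<lambda>x. s * g x + 1 / 2 * (norm (x - z))\<^sup>2) (\<lambda>_. True) (prox s g z)"
    unfolding prox_def arg_min_def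
    by (rule someI[of _ p]) (unfold resc is_arg_min_linorder, use p \<open>s > 0\<close> in auto)
  then have "\<phi> (prox s g z) \<le> \<phi> w" for w
    using \<open>s > 0\<close> unfolding resc is_arg_min_linorder by simp
  from strongly_convex_growth[OF \<phi> this, of w]
  show ?thesis by (simp add: \<phi>_def add_divide_distrib mult.commute[of s 2])
qed

section \<open>Functions with Lipschitz gradient\<close>

lemma smooth_descent:
  fixes f :: "'a::real_inner \<Rightarrow> real"
  assumes "smooth K f" and d: "GDERIV f z :> d"
  shows "f w \<le> f z + d \<bullet> (w - z) + K / 2 * (norm (w - z))\<^sup>2"
proof -
  obtain f' where f': "\<And>z. GDERIV f z :> f' z" and lip: "K-lipschitz_on UNIV f'"
    using assms(1) unfolding smooth_def by blast
  have d_eq: "d = f' z"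
    using d f' by (rule gderiv_unique)
  define u where "u = w - z"
  \<comment> \<open>The excess of \<open>f\<close> over its quadratic upper model along the segment;
    the Lipschitz bound makes its derivative nonpositive, which replaces integration of the
    gradient.\<close>
  define \<phi> where "\<phi> = (\<lambda>t. f (z + t *\<^sub>R u) - t * (f' z \<bullet> u) - K / 2 * t\<^sup>2 * (norm u)\<^sup>2)"
  have "\<phi> 1 \<le> \<phi> 0"
  proof (rule DERIV_nonpos_imp_nonincreasing[of 0 1 \<phi>])
    fix t :: real assume t: "0 \<le> t" "t \<le> 1"
    have "((\<lambda>t. z + t *\<^sub>R u) has_derivative (\<lambda>s. s *\<^sub>R u)) (at t)"
      by (auto intro!: derivative_eq_intros)
    from has_derivative_compose[OF this f'[unfolded gderiv_def]]
    have "((\<lambda>t. f (z + t *\<^sub>R u)) has_real_derivative u \<bullet> f' (z + t *\<^sub>R u)) (at t)"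
      by (simp add: has_field_derivative_def mult.commute[of _ "u \<bullet> f' (z + t *\<^sub>R u)"])
    moreover have "((\<lambda>t. t * (f' z \<bullet> u)) has_real_derivative f' z \<bullet> u) (at t)"
      by (auto intro!: derivative_eq_intros)
    moreover have "((\<lambda>t. K / 2 * t\<^sup>2 * (norm u)\<^sup>2) has_real_derivative K * t * (norm u)\<^sup>2) (at t)"
      by (auto intro!: derivative_eq_intros)
    ultimately have der: "(\<phi> has_real_derivative
        (u \<bullet> f' (z + t *\<^sub>R u) - f' z \<bullet> u - K * t * (norm u)\<^sup>2)) (at t)"
      unfolding \<phi>_def by (intro DERIV_diff)
    have "norm (f' (z + t *\<^sub>R u) - f' z) \<le> K * (t * norm u)"
      using lipschitz_onD[OF lip, of "z + t *\<^sub>R u" z] t by (simp add: dist_norm)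
    then have "norm (f' (z + t *\<^sub>R u) - f' z) * norm u \<le> K * (t * norm u) * norm u"
      by (rule mult_right_mono) simp
    moreover have "(f' (z + t *\<^sub>R u) - f' z) \<bullet> u \<le> norm (f' (z + t *\<^sub>R u) - f' z) * norm u"
      by (rule norm_cauchy_schwarz)
    ultimately have "u \<bullet> f' (z + t *\<^sub>R u) - f' z \<bullet> u - K * t * (norm u)\<^sup>2 \<le> 0"
      by (simp add: inner_diff_left inner_commute[of u] power2_eq_square mult.assoc)
    with der show "\<exists>y. (\<phi> has_real_derivative y) (at t) \<and> y \<le> 0" by blast
  qed simp
  then show ?thesis by (simp add: \<phi>_def u_def d_eq)
qed

text \<open>At one auxiliary point \<open>w\<close>, the tangent of \<open>f\<close> at
  \<open>v\<close> bounds \<open>f w\<close> from below and the quadratic model at \<open>v'\<close>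
  bounds it from above; comparing the two gives the claim.\<close>

lemma smooth_cocoercive:
  fixes f :: "'a::real_inner \<Rightarrow> real"
  assumes cv: "convex_on UNIV f" and sm: "smooth (1 / \<gamma>) f" and "\<gamma> > 0"
    and y: "GDERIV f v :> y" and y': "GDERIV f v' :> y'"
  shows "\<gamma> / 2 * (norm (y' - y))\<^sup>2 \<le> f v' - f v - y \<bullet> (v' - v)"
proof -
  \<comment> \<open>This \<open>w\<close> minimises the quadratic model at \<open>v'\<close> minus
    the tangent at \<open>v\<close>.\<close>
  define w where "w = v' - \<gamma> *\<^sub>R (y' - y)"
  have "f v + y \<bullet> (w - v) \<le> f w"
    by (rule convex_gderiv_le[OF cv y])
  also have "f w \<le> f v' + y' \<bullet> (w - v') + (1 / \<gamma>) / 2 * (norm (w - v'))\<^sup>2"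
    by (rule smooth_descent[OF sm y'])
  also have "(1 / \<gamma>) / 2 * (norm (w - v'))\<^sup>2 = \<gamma> / 2 * ((y' - y) \<bullet> (y' - y))"
    using \<open>\<gamma> > 0\<close> by (simp add: w_def power_mult_distrib power2_norm_eq_inner power2_eq_square[of \<gamma>])
  finally have "f v + y \<bullet> (w - v) \<le> f v' + y' \<bullet> (w - v') + \<gamma> / 2 * ((y' - y) \<bullet> (y' - y))" .
  moreover have "y \<bullet> (w - v) - y' \<bullet> (w - v') = y \<bullet> (v' - v) + \<gamma> * ((y' - y) \<bullet> (y' - y))"
    by (simp add: w_def inner_diff_left inner_diff_right algebra_simps inner_commute)
  ultimately show ?thesis
    unfolding power2_norm_eq_inner by linarith
qed

section \<open>The conjugate\<close>

lemma smooth_gderiv_exists: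
  assumes "smooth K f"
  obtains d where "GDERIV f z :> d"
  using assms unfolding smooth_def by blast

lemma gderiv_linear_minus:
  fixes f :: "'a::real_inner \<Rightarrow> real"
  assumes "GDERIV f z :> d"
  shows "GDERIV (\<lambda>w. f w - y \<bullet> w) z :> d - y"
  using assms unfolding gderiv_def
  by (auto intro!: derivative_eq_intros simp: fun_eq_iff inner_diff_right inner_commute)

lemma conjugate_ge: "ereal (y \<bullet> z - f z) \<le> conjugate f y"
  unfolding conjugate_def by (rule SUP_upper) simp

lemma conjugate_not_minus_infinity: "conjugate f y \<noteq> - \<infinity>"
  using conjugate_ge[of y 0 f] by auto

text \<open>The equality case of the Fenchel-Young inequality: by the tangent inequality the
  supremum is attained at \<open>z\<close>.\<close>

lemma conjugate_gderiv:
  fixes f :: "'a::real_inner \<Rightarrow> real"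
  assumes "convex_on UNIV f" and "GDERIV f z :> y"
  shows "conjugate f y = ereal (y \<bullet> z - f z)"
proof (rule antisym)
  show "conjugate f y \<le> ereal (y \<bullet> z - f z)"
    unfolding conjugate_def
  proof (rule SUP_least)
    fix w
    show "ereal (y \<bullet> w - f w) \<le> ereal (y \<bullet> z - f z)"
      using convex_gderiv_le[OF assms, of w] by (simp add: inner_diff_right)
  qed
qed (rule conjugate_ge)

text \<open>The converse equality case: \<open>z\<close> minimises
  \<open>f w - y \<bullet> w\<close>, so the gradient \<open>d - y\<close> vanishes there.\<close>

lemma gderiv_of_conjugate_le:
  fixes f :: "'a::real_inner \<Rightarrow> real"
  assumes d: "GDERIV f z :> d" and le: "conjugate f y \<le> ereal (y \<bullet> z - f z)"
  shows "GDERIV f z :> y"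
proof -
  have "d - y = 0"
  proof (rule gderiv_minimum_zero[OF gderiv_linear_minus[OF d]])
    fix w
    have "ereal (y \<bullet> w - f w) \<le> ereal (y \<bullet> z - f z)"
      using conjugate_ge le by (rule order_trans)
    then show "f z - y \<bullet> z \<le> f w - y \<bullet> w" by simp
  qed
  then show ?thesis using d by simp
qed

lemma conjugate_chord:
  fixes f :: "'a::real_inner \<Rightarrow> real"
  assumes "conjugate f y = ereal a" and "conjugate f u = ereal b" and "0 \<le> s" "s \<le> 1"
  shows "conjugate f (y + s *\<^sub>R (u - y)) \<le> ereal ((1 - s) * a + s * b)"
  unfolding conjugate_def
proof (rule SUP_least)
  fix z
  have "y \<bullet> z - f z \<le> a" "u \<bullet> z - f z \<le> b"
    using conjugate_ge[of y z f] conjugate_ge[of u z f] assms(1,2) by auto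
  then have "(1 - s) * (y \<bullet> z - f z) + s * (u \<bullet> z - f z) \<le> (1 - s) * a + s * b"
    using assms(3,4) by (intro add_mono mult_left_mono) auto
  moreover have "(y + s *\<^sub>R (u - y)) \<bullet> z - f z = (1 - s) * (y \<bullet> z - f z) + s * (u \<bullet> z - f z)"
    by (simp add: inner_add_left inner_diff_left algebra_simps)
  ultimately show "ereal ((y + s *\<^sub>R (u - y)) \<bullet> z - f z) \<le> ereal ((1 - s) * a + s * b)"
    by simp
qed

text \<open>The tangent inequality of the conjugate at \<open>y\<close> is evaluated at
  \<open>d\<close>, the gradient of \<open>f\<close> at \<open>v\<close>, where the conjugate is
  known exactly. This forces equality in Fenchel-Young for \<open>y\<close> and \<open>v\<close>. It
  is what makes the initial pair behave like all later ones.\<close>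

lemma gderiv_of_conjugate_gradient:
  fixes f :: "'a::real_inner \<Rightarrow> real"
  assumes cv: "convex_on UNIV f" and d: "GDERIV f v :> d"
    and grad: "has_gradient_ereal (conjugate f) y v"
  shows "GDERIV f v :> y"
proof -
  let ?r = "\<lambda>u. real_of_ereal (conjugate f u)"
  have "\<forall>\<^sub>F u in nhds y. \<bar>conjugate f u\<bar> \<noteq> \<infinity>"
    using grad unfolding has_gradient_ereal_def by (rule conjunct1)
  then have "\<bar>conjugate f y\<bar> \<noteq> \<infinity>"
    by (rule eventually_nhds_x_imp_x)
  then obtain a where a: "conjugate f y = ereal a" by auto
  obtain b where b: "conjugate f d = ereal b" and b_eq: "b = d \<bullet> v - f v"
    using conjugate_gderiv[OF cv d] by blast
  have "?r y + v \<bullet> (d - y) \<le> ?r d"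
  proof (rule gderiv_le_of_chord)
    show "GDERIV ?r y :> v" using grad unfolding has_gradient_ereal_def by blast
    fix s :: real assume s: "0 < s" "s \<le> 1"
    have "conjugate f (y + s *\<^sub>R (d - y)) \<le> ereal ((1 - s) * a + s * b)"
      using conjugate_chord[OF a b] s by simp
    then show "?r (y + s *\<^sub>R (d - y)) \<le> (1 - s) * ?r y + s * ?r d"
      using conjugate_not_minus_infinity[of f "y + s *\<^sub>R (d - y)"] a b
      by (cases "conjugate f (y + s *\<^sub>R (d - y))") auto
  qed
  \<comment> \<open>The term \<open>d \<bullet> v\<close> occurs on both sides and cancels.\<close>
  then have "conjugate f y \<le> ereal (y \<bullet> v - f v)"
    using a b b_eq by (simp add: inner_diff_right inner_commute)
  then show ?thesis by (rule gderiv_of_conjugate_le[OF d])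
qed

section \<open>Extreme singular values\<close>

lemma norm_matrix_le_spectral_norm:
  fixes A :: "real^'d^'n"
  shows "norm (A *v x) \<le> spectral_norm A * norm x"
  unfolding spectral_norm_def by (rule onorm) simp

lemma spectral_norm_pos:
  fixes A :: "real^'d^'n"
  assumes "A \<noteq> 0"
  shows "spectral_norm A > 0"
proof -
  have "\<not> (\<forall>x. A *v x = 0)"
    using assms by (metis matrix_eq matrix_vector_mult_0)
  then show ?thesis
    unfolding spectral_norm_def by (subst onorm_pos_lt) auto
qed

lemma inner_gram:
  fixes A :: "real^'d^'n"
  shows "x \<bullet> ((transpose A ** A) *v x) = (norm (A *v x))\<^sup>2"
proof -
  have "x \<bullet> ((transpose A ** A) *v x) = (transpose A *v (A *v x)) \<bullet> x"
    by (metis inner_commute matrix_vector_mul_assoc)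
  also have "\<dots> = (A *v x) \<bullet> (A *v x)"
    by (metis dot_lmul_matrix transpose_matrix_vector)
  finally show ?thesis by (simp add: power2_norm_eq_inner)
qed

text \<open>An eigenvector for \<open>lambda_min\<close> shows that it is nonnegative. For the lower
  bound, \<open>rayleigh_max\<close> is applied to the negated Gram matrix: its top eigenvalue
  \<open>m\<close> gives an eigenvalue \<open>- m\<close> of the Gram matrix that bounds the
  quadratic form from below, and \<open>lambda_min\<close> is at most \<open>- m\<close>.\<close>

lemma lambda_min_gram:
  fixes A :: "real^'d^'n"
  shows "lambda_min (transpose A ** A) \<ge> 0"
    and "lambda_min (transpose A ** A) * (norm x)\<^sup>2 \<le> (norm (A *v x))\<^sup>2"
proof -
  let ?M = "transpose A ** A"
  have sym: "transpose ?M = ?M"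
    by (simp only: matrix_transpose_mul transpose_transpose)
  have "lambda_min ?M \<in> eigenvalues ?M"
    unfolding lambda_min_def by (intro Min_in finite_eigenvalues eigenvalues_nonempty sym)
  then obtain w where w: "w \<noteq> 0" "?M *v w = lambda_min ?M *\<^sub>R w"
    unfolding eigenvalues_def by blast
  have "lambda_min ?M * (norm w)\<^sup>2 = (norm (A *v w))\<^sup>2"
    using inner_gram[of w A] w(2) by (simp add: power2_norm_eq_inner)
  then have "0 \<le> lambda_min ?M * (norm w)\<^sup>2" by simp
  then show "lambda_min ?M \<ge> 0" using w(1) by (simp add: zero_le_mult_iff)
  have neg: "(- ?M) *v z = - (?M *v z)" for z
    by (simp add: matrix_vector_mult_def vec_eq_iff sum_negf)
  have "transpose (- ?M) = - ?M"
    using sym by (simp add: transpose_def vec_eq_iff)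
  then obtain v m where v: "norm v = 1" "(- ?M) *v v = m *\<^sub>R v"
    and bound: "\<And>x. x \<bullet> ((- ?M) *v x) \<le> m * (norm x)\<^sup>2"
    using rayleigh_max by blast
  have "?M *v v = (- m) *\<^sub>R v" using v(2) unfolding neg by (simp add: minus_equation_iff)
  then have "- m \<in> eigenvalues ?M"
    unfolding eigenvalues_def mem_Collect_eq using v(1) by (metis norm_zero zero_neq_one)
  then have "lambda_min ?M \<le> - m"
    unfolding lambda_min_def by (intro Min_le finite_eigenvalues sym)
  then have "lambda_min ?M * (norm x)\<^sup>2 \<le> - m * (norm x)\<^sup>2"
    by (rule mult_right_mono) simp
  also have "\<dots> \<le> (norm (A *v x))\<^sup>2"
    using bound[of x] unfolding neg inner_minus_right inner_gram by simp
  finally show "lambda_min ?M * (norm x)\<^sup>2 \<le> (norm (A *v x))\<^sup>2" .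
qed

section \<open>The saddle point\<close>

text \<open>This trades the extended-valued saddle problem for a real one. Maximality in the dual
  variable, tested against the gradient of \<open>f\<close> at \<open>A *v x\<close>, is equality in
  Fenchel-Young; minimality in the primal variable becomes minimality of the primal
  objective.\<close>

lemma saddle_point_iff:
  fixes A :: "real^'d^'n"
  assumes cf: "convex_on UNIV f" and cg: "convex_on UNIV g" and sm: "smooth K f"
  shows "saddle_point (lagrangian A f g) (x, y) \<longleftrightarrow>
    GDERIV f (A *v x) :> y \<and> (\<forall>w. f (A *v x) + g x \<le> f (A *v w) + g w)"
proof
  assume sp: "saddle_point (lagrangian A f g) (x, y)"
  obtain u where u: "GDERIV f (A *v x) :> u" by (rule smooth_gderiv_exists[OF sm])
  have "lagrangian A f g x u \<le> lagrangian A f g x y"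
    using sp unfolding saddle_point_def by simp
  then have "conjugate f y \<le> ereal (y \<bullet> (A *v x) - f (A *v x))"
    unfolding lagrangian_def conjugate_gderiv[OF cf u]
    using conjugate_not_minus_infinity[of f y] by (cases "conjugate f y") auto
  then have y: "GDERIV f (A *v x) :> y" by (rule gderiv_of_conjugate_le[OF u])
  moreover have "f (A *v x) + g x \<le> f (A *v w) + g w" for w
  proof -
    have "lagrangian A f g x y \<le> lagrangian A f g w y"
      using sp unfolding saddle_point_def by simp
    then have "g x + y \<bullet> (A *v x) \<le> g w + y \<bullet> (A *v w)"
      unfolding lagrangian_def conjugate_gderiv[OF cf y] by simp
    then show ?thesis
      using convex_gderiv_le[OF cf y, of "A *v w"] by (simp add: inner_diff_right)
  qed
  ultimately show "GDERIV f (A *v x) :> y \<and> (\<forall>w. f (A *v x) + g x \<le> f (A *v w) + g w)"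
    by blast
next
  assume "GDERIV f (A *v x) :> y \<and> (\<forall>w. f (A *v x) + g x \<le> f (A *v w) + g w)"
  then have y: "GDERIV f (A *v x) :> y"
    and min: "\<And>w. f (A *v x) + g x \<le> f (A *v w) + g w" by blast+
  have "lagrangian A f g x y' \<le> lagrangian A f g x y" for y'
    using conjugate_ge[of y' "A *v x" f]
    unfolding lagrangian_def conjugate_gderiv[OF cf y]
    by (cases "conjugate f y'") auto
  moreover have "lagrangian A f g x y \<le> lagrangian A f g w y" for w
  proof -
    \<comment> \<open>The first-order change of the objective towards \<open>w\<close>. Smoothness
      of \<open>f\<close> makes the error quadratic in \<open>s\<close>, so it disappears after
      division by \<open>s\<close>.\<close>
    define a where "a = y \<bullet> (A *v w - A *v x) + g w - g x"
    have "0 \<le> a + s * (K / 2 * (norm (A *v w - A *v x))\<^sup>2)" if s: "0 < s" "s \<le> 1" for s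
    proof -
      let ?z = "(1 - s) *\<^sub>R x + s *\<^sub>R w"
      have Az: "A *v ?z - A *v x = s *\<^sub>R (A *v w - A *v x)"
        by (simp add: matrix_vector_right_distrib matrix_vector_mult_scaleR algebra_simps)
      have "f (A *v ?z) \<le> f (A *v x) + s * (y \<bullet> (A *v w - A *v x))
          + K / 2 * (s\<^sup>2 * (norm (A *v w - A *v x))\<^sup>2)"
        using smooth_descent[OF sm y, of "A *v ?z"] unfolding Az
        by (simp add: power_mult_distrib)
      moreover have "g ?z \<le> (1 - s) * g x + s * g w"
        using s by (intro convex_onD[OF cg]) auto
      ultimately have "0 \<le> s * (y \<bullet> (A *v w - A *v x))
          + K / 2 * (s\<^sup>2 * (norm (A *v w - A *v x))\<^sup>2) + ((1 - s) * g x + s * g w) - g x"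
        using min[of ?z] by linarith
      also have "\<dots> = s * (a + s * (K / 2 * (norm (A *v w - A *v x))\<^sup>2))"
        unfolding a_def by algebra
      finally show ?thesis using s by (simp add: zero_le_mult_iff)
    qed
    then have "0 \<le> a" by (rule nonneg_of_le_small_multiples)
    then show ?thesis
      unfolding lagrangian_def conjugate_gderiv[OF cf y] a_def by (simp add: inner_diff_right)
  qed
  ultimately show "saddle_point (lagrangian A f g) (x, y)"
    unfolding saddle_point_def by simp
qed

text \<open>The primal part exists and is unique by strong convexity of the primal objective; the
  dual part is then the gradient of \<open>f\<close> at its image.\<close>

lemma ex1_saddle_point:
  fixes A :: "real^'d^'n"
  assumes cf: "convex_on UNIV f" and cg: "convex_on UNIV g" and sm: "smooth K f"
    and sc: "strongly_convex \<nu> (\<lambda>x. f (A *v x) + g x)" and "\<nu> > 0"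
  shows "\<exists>!p. saddle_point (lagrangian A f g) p"
proof -
  obtain x where x: "\<And>w. f (A *v x) + g x \<le> f (A *v w) + g w"
    using strongly_convex_attains_min[OF sc \<open>\<nu> > 0\<close>] by blast
  obtain y where y: "GDERIV f (A *v x) :> y" by (rule smooth_gderiv_exists[OF sm])
  have "p = (x, y)" if p: "saddle_point (lagrangian A f g) p" for p
  proof -
    obtain x' y' where xy: "p = (x', y')" by force
    have y': "GDERIV f (A *v x') :> y'" and x': "f (A *v x') + g x' \<le> f (A *v x) + g x"
      using p unfolding xy saddle_point_iff[OF cf cg sm] by blast+
    have "\<nu> / 2 * (norm (x' - x))\<^sup>2 \<le> 0"
      using strongly_convex_growth[OF sc x, of x'] x' by linarith
    then have "x' = x" using \<open>\<nu> > 0\<close> by (simp add: mult_le_0_iff)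
    moreover from this have "y' = y" using gderiv_unique y y' by blast
    ultimately show ?thesis by (simp add: xy)
  qed
  moreover have "saddle_point (lagrangian A f g) (x, y)"
    using x y unfolding saddle_point_iff[OF cf cg sm] by blast
  ultimately show ?thesis by blast
qed

section \<open>One step of the iteration\<close>

lemma norm_add_sq_le_weighted:
  fixes a b :: "'a::real_inner"
  assumes "s > 0"
  shows "(norm (a + b))\<^sup>2 \<le> (1 + s) * (norm a)\<^sup>2 + (1 + 1 / s) * (norm b)\<^sup>2"
proof -
  have "0 \<le> (1 / s) * (norm (s *\<^sub>R a - b))\<^sup>2" using assms by simp
  also have "\<dots> = (1 + s) * (norm a)\<^sup>2 + (1 + 1 / s) * (norm b)\<^sup>2 - (norm (a + b))\<^sup>2"
    unfolding power2_norm_eq_inner using assms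
    by (simp add: inner_add inner_diff inner_commute field_simps)
  finally show ?thesis by simp
qed

text \<open>For \<open>d\<close> the gradient of \<open>f\<close> at \<open>u\<close> this is the
  Bregman divergence of \<open>f\<close> from \<open>w\<close> to \<open>u\<close>. It equals the
  divergence of the conjugate between the gradients at these points, in exchanged order.\<close>

definition grad_bregman :: "('a::real_inner \<Rightarrow> real) \<Rightarrow> 'a \<Rightarrow> 'a \<Rightarrow> 'a \<Rightarrow> real" where
  "grad_bregman f d u w = f w - f u - d \<bullet> (w - u)"

text \<open>The dual update is a proximal step in the geometry of the conjugate. As it is solved in
  closed form, its three-point relation is an equality.\<close>

lemma dual_update_identity:
  fixes A :: "real^'d^'n" and f :: "real^'n \<Rightarrow> real"
  assumes "\<sigma> > 0" and v1: "(1 + \<sigma>) *\<^sub>R v1 = v0 + \<sigma> *\<^sub>R (A *v xt)"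
  shows "ys \<bullet> (A *v x1) - (ys \<bullet> (A *v xs) - f (A *v xs)) - (y1 \<bullet> (A *v xs) - (y1 \<bullet> v1 - f v1))
      + (1 + 1 / \<sigma>) * grad_bregman f ys (A *v xs) v1 + 1 / \<sigma> * grad_bregman f y1 v1 v0
    = 1 / \<sigma> * grad_bregman f ys (A *v xs) v0 + y1 \<bullet> (A *v (x1 - xs)) + (ys - y1) \<bullet> (A *v (x1 - xt))"
proof -
  have "v0 - v1 = \<sigma> *\<^sub>R (v1 - A *v xt)"
    using v1 by (simp add: algebra_simps)
  then have "(ys - y1) \<bullet> (v0 - v1) = \<sigma> * ((ys - y1) \<bullet> (v1 - A *v xt))"
    by simp
  then have 1: "1 / \<sigma> * ((ys - y1) \<bullet> (v0 - v1)) = (ys - y1) \<bullet> (v1 - A *v xt)"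
    using \<open>\<sigma> > 0\<close> by simp
  \<comment> \<open>The values of \<open>f\<close> telescope in the three divergences, leaving only
    an inner product.\<close>
  have "grad_bregman f ys (A *v xs) v1 + grad_bregman f y1 v1 v0 - grad_bregman f ys (A *v xs) v0
      = (ys - y1) \<bullet> (v0 - v1)"
    by (simp add: grad_bregman_def inner_diff)
  then have "1 / \<sigma> * grad_bregman f ys (A *v xs) v1 + 1 / \<sigma> * grad_bregman f y1 v1 v0
      - 1 / \<sigma> * grad_bregman f ys (A *v xs) v0 = (ys - y1) \<bullet> (v1 - A *v xt)"
    unfolding 1[symmetric] by (metis right_diff_distrib distrib_left)
  moreover have "ys \<bullet> (A *v x1) - (ys \<bullet> (A *v xs) - f (A *v xs)) - (y1 \<bullet> (A *v xs) - (y1 \<bullet> v1 - f v1))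
      + grad_bregman f ys (A *v xs) v1 + (ys - y1) \<bullet> (v1 - A *v xt)
      = y1 \<bullet> (A *v (x1 - xs)) + (ys - y1) \<bullet> (A *v (x1 - xt))"
    by (simp add: grad_bregman_def inner_diff matrix_vector_mult_diff_distrib)
  ultimately show ?thesis by (simp add: distrib_right)
qed

text \<open>The two Young weights are \<open>1 / \<sigma>\<close> and \<open>1 / (1 + \<sigma>)\<close>: constant weights would not give the
  coefficient required by \<open>\<theta>x\<close> for large \<open>\<sigma>\<close>.\<close>

lemma dual_progress_ge_primal_error:
  fixes A :: "real^'d^'n" and f :: "real^'n \<Rightarrow> real"
  assumes "\<sigma> > 0" and "\<delta> \<ge> 0"
    and v1: "(1 + \<sigma>) *\<^sub>R v1 = v0 + \<sigma> *\<^sub>R (A *v (x0 + \<theta> *\<^sub>R dx))"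
    and D1: "\<delta> / 2 * (norm (v1 - A *v xs))\<^sup>2 \<le> D1"
    and E: "\<delta> / 2 * (norm (v0 - v1))\<^sup>2 \<le> E"
    and lower: "m * (norm (x0 - xs))\<^sup>2 \<le> (norm (A *v (x0 - xs)))\<^sup>2"
    and upper: "norm (A *v dx) \<le> L * norm dx"
  shows "\<delta> * \<sigma> * m / (4 * (2 + \<sigma>)) * (norm (x0 - xs))\<^sup>2
      - \<delta> * \<sigma> / 4 * \<theta>\<^sup>2 * L\<^sup>2 * (norm dx)\<^sup>2 \<le> 1 / 2 * D1 + 1 / (2 * \<sigma>) * E"
proof -
  define p q r where "p = v1 - A *v xs" and "q = v0 - v1"
    and "r = A *v (x0 + \<theta> *\<^sub>R dx - xs)"
  \<comment> \<open>The update rule turns the dual increment into a residual, so the extrapolated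
    primal error \<open>r\<close> splits into the dual error \<open>p\<close> and a multiple of
    \<open>q\<close>.\<close>
  have "q = \<sigma> *\<^sub>R (v1 - A *v (x0 + \<theta> *\<^sub>R dx))"
    using v1 by (simp add: q_def algebra_simps)
  then have "r = p + - ((1 / \<sigma>) *\<^sub>R q)"
    using \<open>\<sigma> > 0\<close> by (simp add: r_def p_def matrix_vector_mult_diff_distrib)
  then have "(norm r)\<^sup>2 \<le> (1 + 1 / \<sigma>) * (norm p)\<^sup>2 + (1 + \<sigma>) * ((norm q)\<^sup>2 / \<sigma>\<^sup>2)"
    using norm_add_sq_le_weighted[of "1 / \<sigma>" p "- ((1 / \<sigma>) *\<^sub>R q)"] \<open>\<sigma> > 0\<close>
    by (simp add: power_divide)
  also have "\<dots> = (1 + \<sigma>) / \<sigma> * ((norm p)\<^sup>2 + (norm q)\<^sup>2 / \<sigma>)"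
    using \<open>\<sigma> > 0\<close> by (simp add: field_simps power2_eq_square)
  finally have r1: "\<sigma> / (1 + \<sigma>) * (norm r)\<^sup>2 \<le> (norm p)\<^sup>2 + (norm q)\<^sup>2 / \<sigma>"
    using \<open>\<sigma> > 0\<close> by (simp add: field_simps)
  \<comment> \<open>Removing the extrapolation with weight \<open>1 / (1 + \<sigma>)\<close>
    produces the common factor \<open>2 + \<sigma>\<close>, the source of the denominator
    \<open>4 + 2 * \<sigma>\<close> in \<open>\<theta>x\<close>.\<close>
  have "A *v (x0 - xs) = r + - (\<theta> *\<^sub>R (A *v dx))"
    by (simp add: r_def matrix_vector_mult_diff_distrib matrix_vector_right_distrib matrix_vector_mult_scaleR)
  then have "(norm (A *v (x0 - xs)))\<^sup>2
      \<le> (1 + 1 / (1 + \<sigma>)) * (norm r)\<^sup>2 + (2 + \<sigma>) * (\<theta>\<^sup>2 * (norm (A *v dx))\<^sup>2)"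
    using norm_add_sq_le_weighted[of "1 / (1 + \<sigma>)" r "- (\<theta> *\<^sub>R (A *v dx))"] \<open>\<sigma> > 0\<close>
    by (simp add: power_mult_distrib)
  also have "\<dots> = (2 + \<sigma>) * (1 / (1 + \<sigma>) * (norm r)\<^sup>2 + \<theta>\<^sup>2 * (norm (A *v dx))\<^sup>2)"
    using \<open>\<sigma> > 0\<close> by (simp add: field_simps)
  finally have "(norm (A *v (x0 - xs)))\<^sup>2 / (2 + \<sigma>)
      \<le> 1 / (1 + \<sigma>) * (norm r)\<^sup>2 + \<theta>\<^sup>2 * (norm (A *v dx))\<^sup>2"
    using \<open>\<sigma> > 0\<close> by (simp add: divide_le_eq mult.commute)
  moreover have "m * (norm (x0 - xs))\<^sup>2 / (2 + \<sigma>) \<le> (norm (A *v (x0 - xs)))\<^sup>2 / (2 + \<sigma>)"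
    using lower \<open>\<sigma> > 0\<close> by (simp add: divide_right_mono)
  moreover have "\<theta>\<^sup>2 * (norm (A *v dx))\<^sup>2 \<le> \<theta>\<^sup>2 * (L\<^sup>2 * (norm dx)\<^sup>2)"
    using power_mono[OF upper norm_ge_zero, of 2]
    by (intro mult_left_mono) (auto simp: power_mult_distrib)
  ultimately have "m * (norm (x0 - xs))\<^sup>2 / (2 + \<sigma>) - \<theta>\<^sup>2 * (L\<^sup>2 * (norm dx)\<^sup>2)
      \<le> 1 / (1 + \<sigma>) * (norm r)\<^sup>2" by linarith
  then have "\<sigma> * (m * (norm (x0 - xs))\<^sup>2 / (2 + \<sigma>) - \<theta>\<^sup>2 * (L\<^sup>2 * (norm dx)\<^sup>2))
      \<le> \<sigma> * (1 / (1 + \<sigma>) * (norm r)\<^sup>2)"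
    using \<open>\<sigma> > 0\<close> by (intro mult_left_mono) auto
  then have "\<sigma> * (m * (norm (x0 - xs))\<^sup>2 / (2 + \<sigma>) - \<theta>\<^sup>2 * (L\<^sup>2 * (norm dx)\<^sup>2))
      \<le> (norm p)\<^sup>2 + (norm q)\<^sup>2 / \<sigma>"
    using r1 by simp
  then have "\<delta> / 4 * (\<sigma> * (m * (norm (x0 - xs))\<^sup>2 / (2 + \<sigma>) - \<theta>\<^sup>2 * (L\<^sup>2 * (norm dx)\<^sup>2)))
      \<le> \<delta> / 4 * ((norm p)\<^sup>2 + (norm q)\<^sup>2 / \<sigma>)"
    using \<open>\<delta> \<ge> 0\<close> by (intro mult_left_mono) auto
  also have "\<dots> = 1 / 2 * (\<delta> / 2 * (norm p)\<^sup>2) + 1 / (2 * \<sigma>) * (\<delta> / 2 * (norm q)\<^sup>2)"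
    by (simp add: field_simps)
  also have "\<dots> \<le> 1 / 2 * D1 + 1 / (2 * \<sigma>) * E"
    using D1 E \<open>\<sigma> > 0\<close> unfolding p_def q_def by (intro add_mono mult_left_mono) auto
  finally show ?thesis by (simp add: right_diff_distrib mult.assoc mult.left_commute)
qed

text \<open>Cauchy-Schwarz followed by Young's inequality. The free weight \<open>k\<close> is
  \<open>1 / (2 * \<sigma>)\<close> in the step estimate and \<open>1 / \<sigma>\<close> in the
  lower bound for the potential.\<close>

lemma bilinear_young:
  fixes A :: "real^'d^'n"
  assumes "norm (A *v dx) \<le> L * norm dx" and "\<gamma> / 2 * (norm z)\<^sup>2 \<le> E"
    and "k > 0" and "\<gamma> > 0"
  shows "z \<bullet> (A *v dx) \<le> k * E + L\<^sup>2 / (2 * k * \<gamma>) * (norm dx)\<^sup>2"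
proof -
  have "z \<bullet> (A *v dx) \<le> norm z * norm (A *v dx)"
    by (rule norm_cauchy_schwarz)
  also have "\<dots> \<le> norm z * (L * norm dx)"
    by (rule mult_left_mono[OF assms(1) norm_ge_zero])
  also have "\<dots> \<le> k * (\<gamma> / 2 * (norm z)\<^sup>2) + L\<^sup>2 / (2 * k * \<gamma>) * (norm dx)\<^sup>2"
  proof -
    have "0 \<le> (k * \<gamma> * norm z - L * norm dx)\<^sup>2 / (2 * k * \<gamma>)"
      using assms by simp
    then show ?thesis using assms(3,4) by (simp add: field_simps power2_eq_square)
  qed
  also have "k * (\<gamma> / 2 * (norm z)\<^sup>2) \<le> k * E"
    using assms by (intro mult_left_mono) auto
  finally show ?thesis by simp
qed

text \<open>\<open>dx\<close> is the last primal increment, and \<open>0\<close> at the start, where the potential is the constant \<open>C\<close>.\<close>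

definition bpd_potential ::
  "real^'d^'n \<Rightarrow> (real^'n \<Rightarrow> real) \<Rightarrow> real \<Rightarrow> real \<Rightarrow> real \<Rightarrow> real^'d \<Rightarrow> real^'n
   \<Rightarrow> real^'d \<Rightarrow> real^'d \<Rightarrow> real^'n \<Rightarrow> real^'n \<Rightarrow> real" where
  "bpd_potential A f \<sigma> \<tau> l xs ys x dx v y =
     (1 / (2 * \<tau>) + l / 2) * (norm (x - xs))\<^sup>2
     + (1 / \<sigma> + 1 / 2) * grad_bregman f ys (A *v xs) v
     - (ys - y) \<bullet> (A *v dx) + 1 / (2 * \<tau>) * (norm dx)\<^sup>2"

text \<open>Adding \<open>prim\<close> and \<open>dual\<close> yields the gap and the new potential,
  with \<open>1 / \<sigma> * E\<close> and half of \<open>D1\<close> to spare. These pay for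
  \<open>coupling\<close> and \<open>err\<close>; then \<open>hX\<close>, \<open>hN\<close> and
  \<open>hD\<close> compare the remaining coefficients with the old potential.\<close>

lemma bpd_step:
  fixes A :: "real^'d^'n" and f :: "real^'n \<Rightarrow> real" and g :: "real^'d \<Rightarrow> real"
  assumes pos: "\<sigma> > 0" "\<tau> > 0" "\<gamma> > 0" "\<delta> \<ge> 0" "l \<ge> 0" and "\<gamma> * \<delta> \<le> 1"
    and \<theta>: "0 \<le> \<theta>" "\<theta> \<le> 1" "1 - \<tau> * \<sigma> * \<delta> * m / (4 + 2 * \<sigma>) \<le> \<theta> * (1 + \<tau> * l)"
      "1 / \<sigma> \<le> \<theta> * (1 / \<sigma> + 1 / 2)"
    and L: "\<tau> * \<sigma> * L\<^sup>2 = \<gamma> / 4" "\<And>x. norm (A *v x) \<le> L * norm x"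
    and m: "\<And>x. m * (norm x)\<^sup>2 \<le> (norm (A *v x))\<^sup>2"
    and f: "strongly_convex \<delta> f" "smooth (1 / \<gamma>) f" and g: "strongly_convex l g"
    and ys: "GDERIV f (A *v xs) :> ys" and y0: "GDERIV f v0 :> y0" and y1: "GDERIV f v1 :> y1"
    and v1: "v1 = (1 / (1 + \<sigma>)) *\<^sub>R (v0 + \<sigma> *\<^sub>R (A *v (x0 + \<theta> *\<^sub>R dx)))"
    and x1: "x1 = prox \<tau> g (x0 - \<tau> *\<^sub>R (transpose A *v y1))"
  shows "g x1 + ys \<bullet> (A *v x1) - (ys \<bullet> (A *v xs) - f (A *v xs))
      - (g xs + y1 \<bullet> (A *v xs) - (y1 \<bullet> v1 - f v1))
      + bpd_potential A f \<sigma> \<tau> l xs ys x1 (x1 - x0) v1 y1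
    \<le> \<theta> * bpd_potential A f \<sigma> \<tau> l xs ys x0 dx v0 y0"
proof -
  define D0 D1 E where "D0 = grad_bregman f ys (A *v xs) v0"
    and "D1 = grad_bregman f ys (A *v xs) v1" and "E = grad_bregman f y1 v1 v0"
  note cv = strongly_convex_imp_convex[OF f(1) pos(4)]
  have v1': "(1 + \<sigma>) *\<^sub>R v1 = v0 + \<sigma> *\<^sub>R (A *v (x0 + \<theta> *\<^sub>R dx))"
    using pos by (simp add: v1)
  have D0_nonneg: "D0 \<ge> 0"
    using convex_gderiv_le[OF cv ys, of v0] by (simp add: D0_def grad_bregman_def)
  have D1_sc: "\<delta> / 2 * (norm (v1 - A *v xs))\<^sup>2 \<le> D1"
    using strongly_convex_gderiv_ge[OF f(1) ys, of v1] by (simp add: D1_def grad_bregman_def)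
  have E_sc: "\<delta> / 2 * (norm (v0 - v1))\<^sup>2 \<le> E"
    using strongly_convex_gderiv_ge[OF f(1) y1, of v0] by (simp add: E_def grad_bregman_def)
  have E_sm: "\<gamma> / 2 * (norm (y1 - y0))\<^sup>2 \<le> E"
    using smooth_cocoercive[OF cv f(2) pos(3) y1 y0]
    by (simp add: E_def grad_bregman_def norm_minus_commute)
  have err: "\<delta> * \<sigma> * m / (4 * (2 + \<sigma>)) * (norm (x0 - xs))\<^sup>2
      - \<delta> * \<sigma> / 4 * \<theta>\<^sup>2 * L\<^sup>2 * (norm dx)\<^sup>2 \<le> 1 / 2 * D1 + 1 / (2 * \<sigma>) * E"
    by (rule dual_progress_ge_primal_error[OF pos(1,4) v1' D1_sc E_sc m L(2)])
  have prim: "g x1 + (1 / (2 * \<tau>) + l / 2) * (norm (x1 - xs))\<^sup>2 + 1 / (2 * \<tau>) * (norm (x1 - x0))\<^sup>2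
      \<le> g xs + 1 / (2 * \<tau>) * (norm (x0 - xs))\<^sup>2 - y1 \<bullet> (A *v (x1 - xs))"
  proof -
    let ?a = "transpose A *v y1"
    have "g x1 + 1 / (2 * \<tau>) * (norm (x1 - (x0 - \<tau> *\<^sub>R ?a)))\<^sup>2
        + (l / 2 + 1 / (2 * \<tau>)) * (norm (xs - x1))\<^sup>2
      \<le> g xs + 1 / (2 * \<tau>) * (norm (xs - (x0 - \<tau> *\<^sub>R ?a)))\<^sup>2"
      unfolding x1 by (rule prox_three_point[OF g pos(5,2)])
    moreover have "(norm (w - (x0 - \<tau> *\<^sub>R ?a)))\<^sup>2
        = (norm (w - x0))\<^sup>2 + 2 * \<tau> * (?a \<bullet> (w - x0)) + \<tau>\<^sup>2 * (?a \<bullet> ?a)" for w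
      unfolding power2_norm_eq_inner
      by (simp add: inner_add inner_diff algebra_simps inner_commute power2_eq_square)
    ultimately have "g x1 + 1 / (2 * \<tau>) * (norm (x1 - x0))\<^sup>2 + ?a \<bullet> (x1 - x0)
        + (l / 2 + 1 / (2 * \<tau>)) * (norm (xs - x1))\<^sup>2
      \<le> g xs + 1 / (2 * \<tau>) * (norm (xs - x0))\<^sup>2 + ?a \<bullet> (xs - x0)"
      using pos(2) by (simp add: distrib_left add_divide_distrib)
    moreover have "?a \<bullet> w = y1 \<bullet> (A *v w)" for w
      by (metis dot_lmul_matrix transpose_matrix_vector)
    ultimately show ?thesis
      by (simp add: norm_minus_commute[of xs] matrix_vector_mult_diff_distrib inner_diff_right
          add.commute[of "l / 2"])
  qed
  note dual = dual_update_identity[OF pos(1) v1', of ys x1 xs f y1, folded D0_def D1_def E_def]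
  \<comment> \<open>Extrapolation exists for this splitting: the new coupling term,
    \<open>\<theta>\<close> times the old one, and a remainder in \<open>y1 - y0\<close> that
    \<open>E\<close> can control.\<close>
  have cross: "(ys - y1) \<bullet> (A *v (x1 - (x0 + \<theta> *\<^sub>R dx)))
      = (ys - y1) \<bullet> (A *v (x1 - x0)) - \<theta> * ((ys - y0) \<bullet> (A *v dx)) + \<theta> * ((y1 - y0) \<bullet> (A *v dx))"
    by (simp add: matrix_vector_mult_diff_distrib matrix_vector_right_distrib
        matrix_vector_mult_scaleR inner_diff inner_add algebra_simps)
  have \<sigma>L: "\<sigma> * L\<^sup>2 = \<gamma> / (4 * \<tau>)"
    using L(1) pos(2) by (simp add: field_simps)
  have coupling: "\<theta> * ((y1 - y0) \<bullet> (A *v dx)) \<le> 1 / (2 * \<sigma>) * E + \<theta>\<^sup>2 / (4 * \<tau>) * (norm dx)\<^sup>2"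
  proof -
    have "(y1 - y0) \<bullet> (A *v (\<theta> *\<^sub>R dx))
        \<le> 1 / (2 * \<sigma>) * E + L\<^sup>2 / (2 * (1 / (2 * \<sigma>)) * \<gamma>) * (norm (\<theta> *\<^sub>R dx))\<^sup>2"
      using pos by (intro bilinear_young[OF L(2) E_sm]) auto
    also have "L\<^sup>2 / (2 * (1 / (2 * \<sigma>)) * \<gamma>) = 1 / (4 * \<tau>)"
      using \<sigma>L pos by (simp add: field_simps)
    finally show ?thesis
      by (simp add: matrix_vector_mult_scaleR power_mult_distrib)
  qed
  have hX: "1 / (2 * \<tau>) * (norm (x0 - xs))\<^sup>2 \<le> \<theta> * ((1 / (2 * \<tau>) + l / 2) * (norm (x0 - xs))\<^sup>2)
      + \<delta> * \<sigma> * m / (4 * (2 + \<sigma>)) * (norm (x0 - xs))\<^sup>2"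
  proof -
    have "1 / (2 * \<tau>) * (1 - \<tau> * \<sigma> * \<delta> * m / (4 + 2 * \<sigma>)) \<le> 1 / (2 * \<tau>) * (\<theta> * (1 + \<tau> * l))"
      using \<theta>(3) pos by (intro mult_left_mono) auto
    moreover have "1 / (2 * \<tau>) * (\<theta> * (1 + \<tau> * l)) = \<theta> * (1 / (2 * \<tau>) + l / 2)"
      using pos by (simp add: field_simps)
    moreover have "1 / (2 * \<tau>) * (\<tau> * \<sigma> * \<delta> * m / (4 + 2 * \<sigma>)) = \<delta> * \<sigma> * m / (4 * (2 + \<sigma>))"
      using pos by (simp add: divide_simps)
    ultimately have "1 / (2 * \<tau>) \<le> \<theta> * (1 / (2 * \<tau>) + l / 2) + \<delta> * \<sigma> * m / (4 * (2 + \<sigma>))"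
      by (simp add: right_diff_distrib)
    then have "1 / (2 * \<tau>) * (norm (x0 - xs))\<^sup>2
        \<le> (\<theta> * (1 / (2 * \<tau>) + l / 2) + \<delta> * \<sigma> * m / (4 * (2 + \<sigma>))) * (norm (x0 - xs))\<^sup>2"
      by (rule mult_right_mono) simp
    then show ?thesis by (simp add: distrib_right mult.assoc)
  qed
  \<comment> \<open>In units of \<open>1 / \<tau>\<close>, the extrapolation error costs at most
    1/16, by \<open>\<gamma> * \<delta> \<le> 1\<close>, and the coupling 1/4; their sum is below
    the available 1/2, and \<open>\<theta>\<^sup>2 \<le> \<theta>\<close>.\<close>
  have hN: "\<delta> * \<sigma> / 4 * \<theta>\<^sup>2 * L\<^sup>2 * (norm dx)\<^sup>2 + \<theta>\<^sup>2 / (4 * \<tau>) * (norm dx)\<^sup>2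
      \<le> \<theta> * (1 / (2 * \<tau>) * (norm dx)\<^sup>2)"
  proof -
    have "\<delta> * (\<sigma> * L\<^sup>2) / 4 = (\<gamma> * \<delta>) * (1 / (16 * \<tau>))"
      unfolding \<sigma>L by simp
    also have "\<dots> \<le> 1 * (1 / (16 * \<tau>))"
      using \<open>\<gamma> * \<delta> \<le> 1\<close> pos by (intro mult_right_mono) auto
    also have "1 * (1 / (16 * \<tau>)) + 1 / (4 * \<tau>) \<le> 1 / (2 * \<tau>)"
      using pos by (simp add: field_simps)
    finally have "\<delta> * (\<sigma> * L\<^sup>2) / 4 + 1 / (4 * \<tau>) \<le> 1 / (2 * \<tau>)" by linarith
    then have "\<theta>\<^sup>2 * (\<delta> * (\<sigma> * L\<^sup>2) / 4 + 1 / (4 * \<tau>)) \<le> \<theta>\<^sup>2 * (1 / (2 * \<tau>))"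
      by (rule mult_left_mono) simp
    also have "\<theta>\<^sup>2 * (1 / (2 * \<tau>)) \<le> \<theta> * (1 / (2 * \<tau>))"
      using \<theta>(1,2) pos by (intro mult_right_mono) (auto simp: power2_eq_square mult_left_le)
    finally have "\<theta>\<^sup>2 * (\<delta> * (\<sigma> * L\<^sup>2) / 4 + 1 / (4 * \<tau>)) * (norm dx)\<^sup>2
        \<le> \<theta> * (1 / (2 * \<tau>)) * (norm dx)\<^sup>2"
      by (rule mult_right_mono) simp
    then show ?thesis by (simp add: algebra_simps)
  qed
  have hD: "1 / \<sigma> * D0 \<le> \<theta> * ((1 / \<sigma> + 1 / 2) * D0)"
    using mult_right_mono[OF \<theta>(4) D0_nonneg] by (simp add: mult.assoc)
  \<comment> \<open>The dual identity supplies \<open>1 + 1 / \<sigma>\<close> copies of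
    \<open>D1\<close>, but the potential keeps only \<open>1 / \<sigma> + 1 / 2\<close>; the
    difference is the half used by \<open>err\<close>.\<close>
  have "bpd_potential A f \<sigma> \<tau> l xs ys x1 (x1 - x0) v1 y1
    = (1 / (2 * \<tau>) + l / 2) * (norm (x1 - xs))\<^sup>2 + (1 + 1 / \<sigma>) * D1 - 1 / 2 * D1
     - (ys - y1) \<bullet> (A *v (x1 - x0)) + 1 / (2 * \<tau>) * (norm (x1 - x0))\<^sup>2"
    by (simp add: bpd_potential_def D1_def distrib_right)
  moreover have "\<theta> * bpd_potential A f \<sigma> \<tau> l xs ys x0 dx v0 y0
    = \<theta> * ((1 / (2 * \<tau>) + l / 2) * (norm (x0 - xs))\<^sup>2) + \<theta> * ((1 / \<sigma> + 1 / 2) * D0)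
     - \<theta> * ((ys - y0) \<bullet> (A *v dx)) + \<theta> * (1 / (2 * \<tau>) * (norm dx)\<^sup>2)"
    unfolding bpd_potential_def D0_def by (simp only: distrib_left right_diff_distrib)
  moreover have "1 / \<sigma> * E = 1 / (2 * \<sigma>) * E + 1 / (2 * \<sigma>) * E"
    by (simp add: field_simps)
  ultimately show ?thesis
    using prim dual cross err coupling hX hN hD by linarith
qed

text \<open>The coupling term is absorbed by \<open>1 / \<sigma>\<close> copies of the divergence
  and part of the increment term, which leaves half a divergence.\<close>

lemma bpd_potential_ge:
  fixes A :: "real^'d^'n"
  assumes pos: "\<sigma> > 0" "\<tau> > 0" "\<gamma> > 0"
    and cv: "convex_on UNIV f" and sm: "smooth (1 / \<gamma>) f"
    and L: "\<tau> * \<sigma> * L\<^sup>2 = \<gamma> / 4" "\<And>x. norm (A *v x) \<le> L * norm x"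
    and ys: "GDERIV f (A *v xs) :> ys" and y: "GDERIV f v :> y"
  shows "(1 / (2 * \<tau>) + l / 2) * (norm (x - xs))\<^sup>2 + 1 / 2 * grad_bregman f ys (A *v xs) v
    \<le> bpd_potential A f \<sigma> \<tau> l xs ys x dx v y"
proof -
  define D where "D = grad_bregman f ys (A *v xs) v"
  have D: "\<gamma> / 2 * (norm (ys - y))\<^sup>2 \<le> D"
    using smooth_cocoercive[OF cv sm pos(3) ys y]
    by (simp add: D_def grad_bregman_def norm_minus_commute)
  have "(ys - y) \<bullet> (A *v dx) \<le> 1 / \<sigma> * D + L\<^sup>2 / (2 * (1 / \<sigma>) * \<gamma>) * (norm dx)\<^sup>2"
    using pos by (intro bilinear_young[OF L(2) D]) auto
  also have "L\<^sup>2 / (2 * (1 / \<sigma>) * \<gamma>) = 1 / (8 * \<tau>)"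
    using L(1) pos by (simp add: field_simps)
  also have "1 / (8 * \<tau>) * (norm dx)\<^sup>2 \<le> 1 / (2 * \<tau>) * (norm dx)\<^sup>2"
    using pos by (intro mult_right_mono) (auto simp: field_simps)
  finally show ?thesis
    unfolding bpd_potential_def D_def[symmetric] distrib_right by linarith
qed

section \<open>Geometric decay for the prescribed parameters\<close>

theorem theorem3:
  fixes A :: "real^'d^'n"
    and f :: "real^'n \<Rightarrow> real"
    and g :: "real^'d \<Rightarrow> real"
    and \<gamma> \<delta> lam \<mu> L \<tau> \<sigma> \<theta>x \<theta>y \<theta> :: real
  assumes "A \<noteq> 0"
    and "convex_on UNIV f" and "convex_on UNIV g"
    and "\<mu> = sqrt (lambda_min (transpose A ** A))"
    and "L = spectral_norm A"
    and "\<gamma> > 0" and "\<delta> \<ge> 0" and "\<gamma> * \<delta> \<le> 1"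
    and "strongly_convex \<delta> f" and "smooth (1 / \<gamma>) f"
    and "lam \<ge> 0" and "strongly_convex lam g"
    and "lam + \<delta> * \<mu>\<^sup>2 > 0"
    and "\<tau> = 1 / (2 * L) * sqrt (\<gamma> / (lam + \<delta> * \<mu>\<^sup>2))"
    and "\<sigma> = 1 / (2 * L) * sqrt (\<gamma> * (lam + \<delta> * \<mu>\<^sup>2))"
    and "\<theta>x = (1 - \<tau> * \<sigma> * \<delta> * \<mu>\<^sup>2 / (4 + 2 * \<sigma>)) * (1 / (1 + \<tau> * lam))"
    and "\<theta>y = 1 / (1 + \<sigma> / 2)"
    and "\<theta> = max \<theta>x \<theta>y"
  shows "(\<exists>!p. saddle_point (lagrangian A f g) p) \<and>
    (\<forall>xs ys x xt v y.
       saddle_point (lagrangian A f g) (xs, ys) \<longrightarrow>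
       dual_free_bpd A f g \<sigma> \<tau> \<theta> x xt v y \<longrightarrow>
       (let D = (\<lambda>t. bregman (conjugate f) (v t) ys (y t));
            C = ereal ((1 / (2 * \<tau>) + lam / 2) * (norm (x 0 - xs))\<^sup>2)
                + ereal (1 / \<sigma> + 1 / 2) * D 0
        in \<forall>t\<ge>1.
             ereal ((1 / (2 * \<tau>) + lam / 2) * (norm (x t - xs))\<^sup>2) + ereal (1 / 2) * D t
               \<le> ereal (\<theta> ^ t) * C \<and>
             lagrangian A f g (x t) ys - lagrangian A f g xs (y t) \<le> ereal (\<theta> ^ t) * C))"
proof (intro conjI allI impI)
  define w where "w = lam + \<delta> * \<mu>\<^sup>2"
  have w: "w > 0" using assms(13) by (simp add: w_def)
  have L: "L > 0" using spectral_norm_pos[OF assms(1)] by (simp add: assms(5))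
  have normA: "norm (A *v z) \<le> L * norm z" for z
    unfolding assms(5) by (rule norm_matrix_le_spectral_norm)
  have "\<mu>\<^sup>2 = lambda_min (transpose A ** A)"
    using lambda_min_gram(1)[of A] by (simp add: assms(4))
  then have lower: "\<mu>\<^sup>2 * (norm z)\<^sup>2 \<le> (norm (A *v z))\<^sup>2" for z
    using lambda_min_gram(2) by simp
  note \<gamma> = assms(6) and \<delta> = assms(7) and sm = assms(10) and lam = assms(11)
  have \<tau>: "\<tau> > 0" and \<sigma>: "\<sigma> > 0"
    using \<gamma> w L by (simp_all add: assms(14,15) flip: w_def)
  \<comment> \<open>In the product of the step sizes \<open>w\<close> cancels; the product alone
    calibrates the coupling bounds.\<close>
  have "\<tau> * \<sigma> = 1 / (4 * L\<^sup>2) * (sqrt (\<gamma> / w) * sqrt (\<gamma> * w))"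
    unfolding assms(14,15) w_def[symmetric] by (simp add: power2_eq_square)
  also have "sqrt (\<gamma> / w) * sqrt (\<gamma> * w) = \<gamma>"
    using \<gamma> w by (simp flip: real_sqrt_mult)
  finally have \<tau>\<sigma>L: "\<tau> * \<sigma> * L\<^sup>2 = \<gamma> / 4"
    using L by simp
  have \<theta>y: "0 < \<theta>y" "\<theta>y < 1" using \<sigma> by (simp_all add: assms(17))
  have "\<theta>x \<le> 1 * (1 / (1 + \<tau> * lam))"
    unfolding assms(16) using \<tau> \<sigma> \<delta> lam by (intro mult_right_mono) auto
  also have "\<dots> \<le> 1" using mult_nonneg_nonneg[of \<tau> lam] \<tau> lam by (simp add: divide_le_eq)
  finally have \<theta>: "0 \<le> \<theta>" "\<theta> \<le> 1" using \<theta>y by (auto simp: assms(18))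
  \<comment> \<open>\<open>\<theta>x\<close> and \<open>\<theta>y\<close> solve the primal and the
    dual coefficient condition with equality, so their maximum satisfies both.\<close>
  have "1 - \<tau> * \<sigma> * \<delta> * \<mu>\<^sup>2 / (4 + 2 * \<sigma>) = \<theta>x * (1 + \<tau> * lam)"
    unfolding assms(16) using \<tau> lam by (simp add: add_nonneg_eq_0_iff)
  also have "\<dots> \<le> \<theta> * (1 + \<tau> * lam)"
    using \<tau> lam by (intro mult_right_mono) (auto simp: assms(18))
  finally have \<theta>3: "1 - \<tau> * \<sigma> * \<delta> * \<mu>\<^sup>2 / (4 + 2 * \<sigma>) \<le> \<theta> * (1 + \<tau> * lam)" .
  have "1 / \<sigma> + 1 / 2 = (1 / \<sigma>) * (1 + \<sigma> / 2)" and "1 + \<sigma> / 2 \<noteq> 0"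
    using \<sigma> by (simp_all add: distrib_left)
  then have "1 / \<sigma> = \<theta>y * (1 / \<sigma> + 1 / 2)"
    unfolding assms(17) by simp
  also have "\<dots> \<le> \<theta> * (1 / \<sigma> + 1 / 2)"
    using \<sigma> by (intro mult_right_mono) (auto simp: assms(18))
  finally have \<theta>4: "1 / \<sigma> \<le> \<theta> * (1 / \<sigma> + 1 / 2)" .

  have sc: "strongly_convex (\<delta> * \<mu>\<^sup>2 + lam) (\<lambda>x. f (A *v x) + g x)"
    by (intro strongly_convex_add strongly_convex_compose_matrix assms(9,12) \<delta> lower)
  show "\<exists>!p. saddle_point (lagrangian A f g) p"
    using ex1_saddle_point[OF assms(2,3) sm sc] w by (simp add: w_def add.commute)

  fix xs ys x xt v y
  assume sp: "saddle_point (lagrangian A f g) (xs, ys)" and run: "dual_free_bpd A f g \<sigma> \<tau> \<theta> x xt v y"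
  define vs where "vs = A *v xs"
  have ys: "GDERIV f vs :> ys"
    using sp unfolding saddle_point_iff[OF assms(2,3) sm] vs_def by blast
  have y: "GDERIV f (v t) :> y t" for t
  proof (cases t)
    case 0
    obtain d where "GDERIV f (v 0) :> d" by (rule smooth_gderiv_exists[OF sm])
    then show ?thesis
      using gderiv_of_conjugate_gradient[OF assms(2)] run 0 unfolding dual_free_bpd_def by blast
  next
    case (Suc s)
    then show ?thesis using run unfolding dual_free_bpd_def by blast
  qed
  \<comment> \<open>Both conjugates are evaluated at gradients of \<open>f\<close>, so they are
    finite and the divergence is real.\<close>
  have D: "bregman (conjugate f) (v t) ys (y t) = ereal (grad_bregman f ys vs (v t))" for t
    unfolding bregman_def conjugate_gderiv[OF assms(2) ys] conjugate_gderiv[OF assms(2) y]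
    by (simp add: grad_bregman_def inner_diff inner_commute)
  define gap where "gap = (\<lambda>t. g (x t) + ys \<bullet> (A *v x t) - (ys \<bullet> vs - f vs)
      - (g xs + y t \<bullet> vs - (y t \<bullet> v t - f (v t))))"
  have gap: "lagrangian A f g (x t) ys - lagrangian A f g xs (y t) = ereal (gap t)" for t
    unfolding lagrangian_def conjugate_gderiv[OF assms(2) ys] conjugate_gderiv[OF assms(2) y]
    by (simp add: gap_def vs_def)
  have gap_nonneg: "gap t \<ge> 0" for t
  proof -
    have "lagrangian A f g xs (y t) \<le> lagrangian A f g (x t) ys"
      using sp unfolding saddle_point_def by (metis fst_conv order_trans snd_conv)
    then show ?thesis
      unfolding lagrangian_def conjugate_gderiv[OF assms(2) ys] conjugate_gderiv[OF assms(2) y]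
      by (simp add: gap_def vs_def)
  qed
  \<comment> \<open>The value 0 at the start encodes \<open>xt 0 = x 0\<close> and makes the initial
    potential equal to \<open>C\<close>.\<close>
  define dx where "dx = (\<lambda>t. case t of 0 \<Rightarrow> 0 | Suc s \<Rightarrow> x (Suc s) - x s)"
  have xt: "xt t = x t + \<theta> *\<^sub>R dx t" for t
    using run unfolding dual_free_bpd_def dx_def by (cases t) auto
  define \<Phi> where "\<Phi> = (\<lambda>t. bpd_potential A f \<sigma> \<tau> lam xs ys (x t) (dx t) (v t) (y t))"
  have step: "gap (Suc t) + \<Phi> (Suc t) \<le> \<theta> * \<Phi> t" for t
  proof -
    have "v (Suc t) = (1 / (1 + \<sigma>)) *\<^sub>R (v t + \<sigma> *\<^sub>R (A *v (x t + \<theta> *\<^sub>R dx t)))"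
      and "x (Suc t) = prox \<tau> g (x t - \<tau> *\<^sub>R (transpose A *v y (Suc t)))"
      using run unfolding dual_free_bpd_def xt by blast+
    from bpd_step[OF \<sigma> \<tau> \<gamma> \<delta> lam assms(8) \<theta> \<theta>3 \<theta>4 \<tau>\<sigma>L normA lower assms(9) sm assms(12)
        ys[unfolded vs_def] y y this]
    show ?thesis by (simp add: gap_def \<Phi>_def vs_def dx_def)
  qed
  have decay: "\<Phi> t \<le> \<theta> ^ t * \<Phi> 0" for t
  proof (induction t)
    case (Suc t)
    have "\<Phi> (Suc t) \<le> \<theta> * \<Phi> t" using step[of t] gap_nonneg[of "Suc t"] by linarith
    also have "\<dots> \<le> \<theta> * (\<theta> ^ t * \<Phi> 0)" using Suc \<theta>(1) by (rule mult_left_mono)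
    finally show ?case by simp
  qed simp
  have \<Phi>_ge: "(1 / (2 * \<tau>) + lam / 2) * (norm (x t - xs))\<^sup>2 + 1 / 2 * grad_bregman f ys vs (v t) \<le> \<Phi> t" for t
    unfolding \<Phi>_def vs_def
    by (rule bpd_potential_ge[OF \<sigma> \<tau> \<gamma> assms(2) sm \<tau>\<sigma>L normA ys[unfolded vs_def] y])
  have \<Phi>_nonneg: "\<Phi> t \<ge> 0" for t
  proof -
    have "0 \<le> grad_bregman f ys vs (v t)"
      using convex_gderiv_le[OF assms(2) ys, of "v t"] by (simp add: grad_bregman_def)
    moreover have "0 \<le> (1 / (2 * \<tau>) + lam / 2) * (norm (x t - xs))\<^sup>2"
      using \<tau> lam by simp
    ultimately show ?thesis using \<Phi>_ge[of t] by linarith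
  qed
  \<comment> \<open>Here the new potential is dropped from \<open>step\<close>, where
    \<open>decay\<close> drops the gap. A gap is bounded through the preceding step, hence
    \<open>t \<ge> 1\<close>.\<close>
  have gap_le: "gap t \<le> \<theta> ^ t * \<Phi> 0" if t: "t \<ge> 1" for t
  proof -
    obtain s where s: "t = Suc s" using t by (cases t) auto
    have "gap t \<le> \<theta> * \<Phi> s" using step[of s] \<Phi>_nonneg[of t] unfolding s by linarith
    also have "\<dots> \<le> \<theta> * (\<theta> ^ s * \<Phi> 0)" using decay \<theta>(1) by (rule mult_left_mono)
    finally show ?thesis by (simp add: s)
  qed
  have \<Phi>0: "\<Phi> 0 = (1 / (2 * \<tau>) + lam / 2) * (norm (x 0 - xs))\<^sup>2
      + (1 / \<sigma> + 1 / 2) * grad_bregman f ys vs (v 0)"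
    by (simp add: \<Phi>_def bpd_potential_def dx_def vs_def)
  show "let D = (\<lambda>t. bregman (conjugate f) (v t) ys (y t));
            C = ereal ((1 / (2 * \<tau>) + lam / 2) * (norm (x 0 - xs))\<^sup>2)
                + ereal (1 / \<sigma> + 1 / 2) * D 0
        in \<forall>t\<ge>1.
             ereal ((1 / (2 * \<tau>) + lam / 2) * (norm (x t - xs))\<^sup>2) + ereal (1 / 2) * D t
               \<le> ereal (\<theta> ^ t) * C \<and>
             lagrangian A f g (x t) ys - lagrangian A f g xs (y t) \<le> ereal (\<theta> ^ t) * C"
    unfolding Let_def D gap times_ereal.simps plus_ereal.simps ereal_less_eq \<Phi>0[symmetric]
    using order_trans[OF \<Phi>_ge decay] gap_le by blast
qed

end
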